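(* For parameters $\alpha,\beta$ and variables $x_1,\dots,x_m$, $y_1,\dots,y_n$, $$\sum_{\lambda}G^{(-\alpha,-\beta)}_\lambda(x_1,\dots,x_m)\,g^{(\alpha,\beta)}_\lambda(y_1,\dots,y_n)=\prod_{1\le i\le m,\,1\le j\le n}\frac{1}{1-x_iy_j},$$ the sum running over all partitions $\lambda$ (an identity of formal power series).
   Context: Canonical Grothendieck polynomials: for $\mu\subseteq\lambda$, $\lambda/\mu$ is a horizontal strip if $\lambda_1\ge\mu_1\ge\lambda_2\ge\cdots$; $\bar\lambda=(\lambda_2,\lambda_3,\dots)$; $r(\kappa/\nu)$ is the number of $i$ with $\kappa_i>\nu_i$. $G^{(\alpha,\beta)}_\lambda()=\delta_{\lambda,\emptyset}$ (no variables) and $G^{(\alpha,\beta)}_\lambda(x_1,\dots,x_{n+1})=\sum_{\mu:\lambda/\mu\text{ horizontal strip}}G^{(\alpha,\beta)}_\mu(x_1,\dots,x_n)\big(\frac{x}{1-\alpha x}\big)^{|\lambda|-|\mu|}\big(\frac{1+\beta x}{1-\alpha x}\big)^{r(\mu/\bar\lambda)}$, $x=x_{n+1}$; $G^{(-\alpha,-\beta)}$ is obtained by replacing $(\alpha,\beta)$ with $(-\alpha,-\beta)$. Dual canonical Grothendieck polynomials: for $\mu\subseteq\lambda$ let $r,c,b$ be the numbers of nonempty rows, nonempty columns and edge-connected components of $\lambda/\mu$; $g^{(\alpha,\beta)}_\lambda()=\delta_{\lambda,\emptyset}$ and $g^{(\alpha,\beta)}_\lambda(x_1,\dots,x_{n+1})=\sum_{\mu\subseteq\lambda}g^{(\alpha,\beta)}_\mu(x_1,\dots,x_n)\beta^{r-b}(\alpha+\beta)^{|\lambda|-|\mu|-r-c+b}x_{n+1}^{b}(\alpha+x_{n+1})^{c-b}$.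 *)

theory Defs
  imports "HOL-Library.Poly_Mapping"
begin

section \<open>Multivariate formal power series\<close>

text \<open>
  Formal power series over \<open>'a\<close> in the variables indexed by \<open>'v\<close> (possibly infinitely many):
  arbitrary families of coefficients, indexed by the monomials \<open>'v \<Rightarrow>\<^sub>0 nat\<close>.
\<close>

typedef ('v, 'a) mfps = "UNIV :: (('v \<Rightarrow>\<^sub>0 nat) \<Rightarrow> 'a) set"
  morphisms mfps_coeff Abs_mfps ..

setup_lifting type_definition_mfps

lemma mfps_coeff_Abs [simp]: "mfps_coeff (Abs_mfps f) = f"
  by (simp add: Abs_mfps_inverse)

lemma mfps_eqI: "(\<And>m. mfps_coeff f m = mfps_coeff g m) \<Longrightarrow> f = g"
  by (metis ext mfps_coeff_inject)

lemma finite_le_fun: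
  fixes u :: "'b \<Rightarrow> nat"
  assumes "finite {i. u i \<noteq> 0}"
  shows "finite {f. \<forall>i. f i \<le> u i}"
proof (rule finite_subset)
  let ?A = "{i. u i \<noteq> 0}"
  let ?F = "{f. \<forall>i. (i \<in> ?A \<longrightarrow> f i \<in> {..Max (u ` ?A)}) \<and> (i \<notin> ?A \<longrightarrow> f i = 0)}"
  show "{f. \<forall>i. f i \<le> u i} \<subseteq> ?F"
  proof (rule subsetI)
    fix f assume "f \<in> {f. \<forall>i. f i \<le> u i}"
    then have f: "f i \<le> u i" for i by simp
    have "f i \<le> Max (u ` ?A)" if "i \<in> ?A" for i
      by (rule order.trans[OF f Max_ge]) (use assms that in auto)
    moreover have "f i = 0" if "i \<notin> ?A" for i
      using f[of i] that by simp
    ultimately show "f \<in> ?F" by simp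
  qed
  show "finite ?F"
    by (rule finite_set_of_finite_funs[OF assms]) simp
qed

lemma finite_le_lookup:
  fixes m :: "'v \<Rightarrow>\<^sub>0 nat"
  shows "finite {a. \<forall>i. Poly_Mapping.lookup a i \<le> Poly_Mapping.lookup m i}"
proof (rule finite_imageD)
  show "finite (Poly_Mapping.lookup ` {a. \<forall>i. Poly_Mapping.lookup a i \<le> Poly_Mapping.lookup m i})"
    by (rule finite_subset[OF _ finite_le_fun[of "Poly_Mapping.lookup m"]]) auto
  show "inj_on Poly_Mapping.lookup {a. \<forall>i. Poly_Mapping.lookup a i \<le> Poly_Mapping.lookup m i}"
    by (simp add: inj_on_def lookup_inject)
qed

lemma finite_monomial_splits: "finite {(a, b). a + b = (m :: 'v \<Rightarrow>\<^sub>0 nat)}"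
proof (rule finite_subset)
  let ?L = "{a. \<forall>i. Poly_Mapping.lookup a i \<le> Poly_Mapping.lookup m i}"
  show "{(a, b). a + b = m} \<subseteq> ?L \<times> ?L"
    by (auto simp: lookup_add)
  show "finite (?L \<times> ?L)"
    by (intro finite_cartesian_product finite_le_lookup)
qed

instantiation mfps :: (type, comm_ring_1) comm_ring_1
begin

lift_definition zero_mfps :: "('a, 'b) mfps" is "\<lambda>_. 0" .
lift_definition one_mfps :: "('a, 'b) mfps" is "\<lambda>m. if m = 0 then 1 else 0" .
lift_definition plus_mfps :: "('a, 'b) mfps \<Rightarrow> ('a, 'b) mfps \<Rightarrow> ('a, 'b) mfps"
  is "\<lambda>f g m. f m + g m" .
lift_definition minus_mfps :: "('a, 'b) mfps \<Rightarrow> ('a, 'b) mfps \<Rightarrow> ('a, 'b) mfps"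
  is "\<lambda>f g m. f m - g m" .
lift_definition uminus_mfps :: "('a, 'b) mfps \<Rightarrow> ('a, 'b) mfps"
  is "\<lambda>f m. - f m" .
lift_definition times_mfps :: "('a, 'b) mfps \<Rightarrow> ('a, 'b) mfps \<Rightarrow> ('a, 'b) mfps"
  is "\<lambda>f g m. \<Sum>(a, b) | a + b = m. f a * g b" .

instance
proof
  fix f g h :: "('a, 'b) mfps"
  show "f + g + h = f + (g + h)" by transfer (simp add: add.assoc)
  show "f + g = g + f" by transfer (simp add: add.commute)
  show "0 + f = f" by transfer simp
  show "- f + f = 0" by transfer simp
  show "f - g = f + - g" by transfer simp
  show "f * g = g * f"
  proof (transfer, rule ext)
    fix f g :: "('a \<Rightarrow>\<^sub>0 nat) \<Rightarrow> 'b" and m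
    show "(\<Sum>(a, b) | a + b = m. f a * g b) = (\<Sum>(a, b) | a + b = m. g a * f b)"
      by (rule sum.reindex_bij_witness[of _ prod.swap prod.swap])
        (auto simp: add.commute mult.commute)
  qed
  show "(f + g) * h = f * h + g * h"
    by transfer (simp add: distrib_right sum.distrib case_prod_unfold)
  show "1 * f = f"
  proof (transfer, rule ext)
    fix f :: "('a \<Rightarrow>\<^sub>0 nat) \<Rightarrow> 'b" and m
    have "(\<Sum>(a, b) | a + b = m. (if a = 0 then 1 else 0) * f b)
        = (\<Sum>p \<in> {(a, b). a + b = m}. if p = (0, m) then f m else 0)"
      by (rule sum.cong) (auto split: if_splits)
    then show "(\<Sum>(a, b) | a + b = m. (if a = 0 then 1 else 0) * f b) = f m"
      by (simp add: finite_monomial_splits)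
  qed
  show "f * g * h = f * (g * h)"
  proof (transfer, rule ext)
    fix f g h :: "('a \<Rightarrow>\<^sub>0 nat) \<Rightarrow> 'b" and m
    let ?S = "\<lambda>m. {(a, b). a + b = (m :: 'a \<Rightarrow>\<^sub>0 nat)}"
    have fin: "finite (?S k)" for k by (rule finite_monomial_splits)
    have "(\<Sum>(d, c) \<in> ?S m. (\<Sum>(a, b) \<in> ?S d. f a * g b) * h c)
        = (\<Sum>p \<in> ?S m. \<Sum>q \<in> ?S (fst p). f (fst q) * g (snd q) * h (snd p))"
      by (simp add: case_prod_unfold sum_distrib_right)
    also have "\<dots> = (\<Sum>(p, q) \<in> Sigma (?S m) (\<lambda>p. ?S (fst p)).
        f (fst q) * g (snd q) * h (snd p))"
      by (rule sum.Sigma) (auto simp: fin)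
    also have "\<dots> = (\<Sum>(p, q) \<in> Sigma (?S m) (\<lambda>p. ?S (snd p)).
        f (fst p) * (g (fst q) * h (snd q)))"
      by (rule sum.reindex_bij_witness
          [of _ "\<lambda>(p, q). ((fst p + fst q, snd q), (fst p, fst q))"
                "\<lambda>(p, q). ((fst q, snd q + snd p), (snd q, snd p))"])
        (auto simp: add.assoc mult.assoc)
    also have "\<dots> = (\<Sum>p \<in> ?S m. \<Sum>q \<in> ?S (snd p). f (fst p) * (g (fst q) * h (snd q)))"
      by (rule sum.Sigma [symmetric]) (auto simp: fin)
    also have "\<dots> = (\<Sum>(a, d) \<in> ?S m. f a * (\<Sum>(b, c) \<in> ?S d. g b * h c))"
      by (simp add: case_prod_unfold sum_distrib_left)
    finally show "(\<Sum>(d, c) \<in> ?S m. (\<Sum>(a, b) \<in> ?S d. f a * g b) * h c)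
        = (\<Sum>(a, d) \<in> ?S m. f a * (\<Sum>(b, c) \<in> ?S d. g b * h c))" .
  qed
  show "(0 :: ('a, 'b) mfps) \<noteq> 1"
    by transfer (metis zero_neq_one)
qed

end

text \<open>
  As for univariate series, \<open>inverse\<close> yields the multiplicative inverse of a unit
  and \<open>0\<close> for a non-unit; no inverses are needed in the coefficient ring.
\<close>

instantiation mfps :: (type, comm_ring_1) inverse
begin

definition mfps_inverse_def:
  "inverse (f :: ('a, 'b) mfps) = (if f dvd 1 then THE g. f * g = 1 else 0)"

definition mfps_divide_def:
  "(f :: ('a, 'b) mfps) div g = f * inverse g"

instance ..

end

lemma mfps_inverse_unique:
  fixes f g :: "('v, 'a::comm_ring_1) mfps"
  assumes "f * g = 1"
  shows "inverse f = g"
proof -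
  have "h = g" if "f * h = 1" for h
  proof -
    have "h = (f * g) * h" by (simp add: assms)
    also have "\<dots> = (f * h) * g" by (simp only: mult_ac)
    finally show ?thesis by (simp add: that)
  qed
  then have "(THE h. f * h = 1) = g"
    using assms by (rule the_equality[rotated])
  moreover have "f dvd 1"
    using assms by (intro dvdI) (rule sym)
  ultimately show ?thesis
    by (simp add: mfps_inverse_def)
qed

definition mfps_const :: "'a::comm_ring_1 \<Rightarrow> ('v, 'a) mfps" where
  "mfps_const c = Abs_mfps (\<lambda>m. if m = 0 then c else 0)"

definition mfps_var :: "'v \<Rightarrow> ('v, 'a::comm_ring_1) mfps" where
  "mfps_var v = Abs_mfps (\<lambda>m. if m = Poly_Mapping.single v 1 then 1 else 0)"

text \<open>
  Infinite sums of formal power series: each monomial occurs in only finitely many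
  terms, and the sum is taken coefficientwise.
\<close>

definition mfps_has_sum ::
  "('i \<Rightarrow> ('v, 'a::comm_ring_1) mfps) \<Rightarrow> 'i set \<Rightarrow> ('v, 'a) mfps \<Rightarrow> bool" where
  "mfps_has_sum f A s \<longleftrightarrow>
     (\<forall>m. finite {i \<in> A. mfps_coeff (f i) m \<noteq> 0} \<and>
          mfps_coeff s m = (\<Sum>i | i \<in> A \<and> mfps_coeff (f i) m \<noteq> 0. mfps_coeff (f i) m))"


section \<open>Partitions and skew shapes\<close>

text \<open>Parts are indexed from \<open>0\<close>: the part \<open>\<lambda>\<^sub>i\<^sub>+\<^sub>1\<close> is \<open>\<lambda> i\<close>. Containment is the pointwise order.\<close>

definition partitions :: "(nat \<Rightarrow> nat) set" where
  "partitions = {la. antimono la \<and> finite {i. la i \<noteq> 0}}"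

definition empty_partition :: "nat \<Rightarrow> nat" where
  "empty_partition = (\<lambda>_. 0)"

definition psize :: "(nat \<Rightarrow> nat) \<Rightarrow> nat" where
  "psize la = (\<Sum>i | la i \<noteq> 0. la i)"

definition drop_first :: "(nat \<Rightarrow> nat) \<Rightarrow> (nat \<Rightarrow> nat)" where
  "drop_first la = (\<lambda>i. la (Suc i))"

definition horizontal_strip :: "(nat \<Rightarrow> nat) \<Rightarrow> (nat \<Rightarrow> nat) \<Rightarrow> bool" where
  "horizontal_strip la mu \<longleftrightarrow> (\<forall>i. mu i \<le> la i \<and> la (Suc i) \<le> mu i)"

definition row_excess :: "(nat \<Rightarrow> nat) \<Rightarrow> (nat \<Rightarrow> nat) \<Rightarrow> nat" where
  "row_excess ka nu = card {i. ka i > nu i}"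

definition skew_cells :: "(nat \<Rightarrow> nat) \<Rightarrow> (nat \<Rightarrow> nat) \<Rightarrow> (nat \<times> nat) set" where
  "skew_cells la mu = {(i, j). mu i \<le> j \<and> j < la i}"

definition num_rows :: "(nat \<times> nat) set \<Rightarrow> nat" where
  "num_rows D = card (fst ` D)"

definition num_cols :: "(nat \<times> nat) set \<Rightarrow> nat" where
  "num_cols D = card (snd ` D)"

definition edge_adjacent :: "(nat \<times> nat) set \<Rightarrow> ((nat \<times> nat) \<times> (nat \<times> nat)) set" where
  "edge_adjacent D = {((i, j), (k, l)). (i, j) \<in> D \<and> (k, l) \<in> D \<and>
     (i = k \<and> (l = Suc j \<or> j = Suc l) \<or> j = l \<and> (k = Suc i \<or> i = Suc k))}"

definition num_components :: "(nat \<times> nat) set \<Rightarrow> nat" where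
  "num_components D = card (D // (edge_adjacent D)\<^sup>*)"

lemma finite_subpartitions:
  assumes "la \<in> partitions"
  shows "finite {mu \<in> partitions. mu \<le> la}"
  by (rule finite_subset[OF _ finite_le_fun[of la]])
    (use assms in \<open>auto simp: partitions_def le_fun_def\<close>)


section \<open>Canonical Grothendieck polynomials and their duals\<close>

text \<open>
  \<open>canonical_G \<alpha> \<beta> x n \<lambda>\<close> and \<open>dual_g \<alpha> \<beta> x n \<lambda>\<close> are
  \<open>G\<^sub>\<lambda>(x\<^sub>1, \<dots>, x\<^sub>n)\<close> and \<open>g\<^sub>\<lambda>(x\<^sub>1, \<dots>, x\<^sub>n)\<close> for the parameters \<open>\<alpha>, \<beta>\<close>; the values
  \<open>x 0\<close> and \<open>x i\<close> with \<open>i > n\<close> are not used. By the lemma above, the sums over \<open>\<mu>\<close> are finite.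
\<close>

fun canonical_G ::
  "'a::comm_ring_1 \<Rightarrow> 'a \<Rightarrow> (nat \<Rightarrow> ('v, 'a) mfps) \<Rightarrow> nat \<Rightarrow> (nat \<Rightarrow> nat) \<Rightarrow> ('v, 'a) mfps" where
  "canonical_G \<alpha> \<beta> x 0 la = (if la = empty_partition then 1 else 0)"
| "canonical_G \<alpha> \<beta> x (Suc n) la =
    (\<Sum>mu | mu \<in> partitions \<and> horizontal_strip la mu.
       canonical_G \<alpha> \<beta> x n mu *
       (x (Suc n) / (1 - mfps_const \<alpha> * x (Suc n))) ^ (psize la - psize mu) *
       ((1 + mfps_const \<beta> * x (Suc n)) / (1 - mfps_const \<alpha> * x (Suc n)))
         ^ row_excess mu (drop_first la))"

text \<open>
  Every row and every column of a skew shape lies in a single component, and a connected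
  shape with \<open>r\<close> rows and \<open>c\<close> columns has at least \<open>r + c - 1\<close> cells;
  hence none of the subtractions in \<open>dual_weight\<close> is truncated when \<open>\<mu> \<subseteq> \<lambda>\<close>.
\<close>

definition dual_weight ::
  "'a::comm_ring_1 \<Rightarrow> 'a \<Rightarrow> ('v, 'a) mfps \<Rightarrow> (nat \<Rightarrow> nat) \<Rightarrow> (nat \<Rightarrow> nat) \<Rightarrow> ('v, 'a) mfps" where
  "dual_weight \<alpha> \<beta> y la mu =
    (let D = skew_cells la mu; r = num_rows D; c = num_cols D; b = num_components D
     in mfps_const \<beta> ^ (r - b) *
        mfps_const (\<alpha> + \<beta>) ^ ((psize la - psize mu + b) - (r + c)) *
        y ^ b * (mfps_const \<alpha> + y) ^ (c - b))"

fun dual_g ::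
  "'a::comm_ring_1 \<Rightarrow> 'a \<Rightarrow> (nat \<Rightarrow> ('v, 'a) mfps) \<Rightarrow> nat \<Rightarrow> (nat \<Rightarrow> nat) \<Rightarrow> ('v, 'a) mfps" where
  "dual_g \<alpha> \<beta> y 0 la = (if la = empty_partition then 1 else 0)"
| "dual_g \<alpha> \<beta> y (Suc n) la =
    (\<Sum>mu | mu \<in> partitions \<and> mu \<le> la. dual_g \<alpha> \<beta> y n mu * dual_weight \<alpha> \<beta> (y (Suc n)) la mu)"

end

theory Submission
  imports Defs
begin

text \<open>
  The identity follows by induction on the numbers of variables from the skew Cauchy identity in
  one variable \<open>x\<close> and one variable \<open>y\<close>,
  \<open>\<Sum>\<^sub>\<lambda> G\<^sub>\<lambda>\<^sub>/\<^sub>\<mu>(x) g\<^sub>\<lambda>\<^sub>/\<^sub>\<nu>(y) = 1 / (1 - x y) \<Sum>\<^sub>\<kappa> G\<^sub>\<nu>\<^sub>/\<^sub>\<kappa>(x) g\<^sub>\<mu>\<^sub>/\<^sub>\<kappa>(y)\<close>,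
  where \<open>G\<close> and \<open>g\<close> denote the one-variable branching weights. For fixed \<open>\<mu>\<close> and \<open>\<nu>\<close>, the interlacing
  conditions leave the parts of \<open>\<lambda>\<close> (and those of \<open>\<kappa>\<close>) independent of each other, and both weights
  are products over rows, so both sides are products of sums over a single part. With
  \<open>u = x / (1 + \<alpha> x)\<close> the weight \<open>(1 - \<beta> x) / (1 + \<alpha> x)\<close> is \<open>1 - (\<alpha> + \<beta>) u\<close>, which makes the sums
  telescope: the factor for \<open>\<lambda>\<^sub>i\<^sub>+\<^sub>1\<close> equals the factor for \<open>\<kappa>\<^sub>i\<close> up to a coboundary in \<open>i\<close>, and the
  geometric series over the unbounded first part \<open>\<lambda>\<^sub>1\<close> contributes \<open>1 / (1 - x y)\<close>.
\<close>

section \<open>Summable families of power series\<close>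

lemma mfps_coeff_simps [simp]:
  "mfps_coeff 0 m = 0"
  "mfps_coeff (f + g) m = mfps_coeff f m + mfps_coeff g m"
  "mfps_coeff (f - g) m = mfps_coeff f m - mfps_coeff g m"
  "mfps_coeff (- f) m = - mfps_coeff f m"
  by (simp_all add: zero_mfps.rep_eq plus_mfps.rep_eq minus_mfps.rep_eq uminus_mfps.rep_eq)

lemma mfps_coeff_mult:
  "mfps_coeff (f * g) m = (\<Sum>(a, b) | a + b = m. mfps_coeff f a * mfps_coeff g b)"
  by (simp add: times_mfps.rep_eq)

lemma mfps_coeff_sum: "mfps_coeff (sum f A) m = (\<Sum>i\<in>A. mfps_coeff (f i) m)"
  by (induction A rule: infinite_finite_induct) auto

text \<open>Zero terms do not change a sum, so any finite index set outside of which the coefficient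
  vanishes may replace the exact support. It may depend on the monomial.\<close>

lemma mfps_has_sumI:
  assumes "\<And>m. \<exists>F. finite F \<and> F \<subseteq> A \<and> (\<forall>i\<in>A - F. mfps_coeff (f i) m = 0) \<and>
    mfps_coeff s m = (\<Sum>i\<in>F. mfps_coeff (f i) m)"
  shows "mfps_has_sum f A s"
  unfolding mfps_has_sum_def
proof (rule allI)
  fix m
  obtain F where F: "finite F" "F \<subseteq> A" "\<forall>i\<in>A - F. mfps_coeff (f i) m = 0"
    "mfps_coeff s m = (\<Sum>i\<in>F. mfps_coeff (f i) m)"
    using assms[of m] by blast
  have sub: "{i \<in> A. mfps_coeff (f i) m \<noteq> 0} \<subseteq> F"
    using F(3) by auto
  have "(\<Sum>i\<in>{i \<in> A. mfps_coeff (f i) m \<noteq> 0}. mfps_coeff (f i) m) = (\<Sum>i\<in>F. mfps_coeff (f i) m)"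
    using F sub by (intro sum.mono_neutral_left) auto
  then show "finite {i \<in> A. mfps_coeff (f i) m \<noteq> 0} \<and>
      mfps_coeff s m = (\<Sum>i | i \<in> A \<and> mfps_coeff (f i) m \<noteq> 0. mfps_coeff (f i) m)"
    using F finite_subset[OF sub] by simp
qed

lemma mfps_has_sum_finite_support:
  "mfps_has_sum f A s \<Longrightarrow> finite {i \<in> A. mfps_coeff (f i) m \<noteq> 0}"
  by (simp add: mfps_has_sum_def)

lemma mfps_has_sum_coeff:
  assumes "mfps_has_sum f A s" "finite F" "F \<subseteq> A" "{i \<in> A. mfps_coeff (f i) m \<noteq> 0} \<subseteq> F"
  shows "mfps_coeff s m = (\<Sum>i\<in>F. mfps_coeff (f i) m)"
proof -
  have "mfps_coeff s m = (\<Sum>i | i \<in> A \<and> mfps_coeff (f i) m \<noteq> 0. mfps_coeff (f i) m)"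
    using assms(1) by (simp add: mfps_has_sum_def)
  also have "\<dots> = (\<Sum>i\<in>F. mfps_coeff (f i) m)"
    using assms by (intro sum.mono_neutral_left) auto
  finally show ?thesis .
qed

lemma mfps_has_sum_unique: "mfps_has_sum f A s \<Longrightarrow> mfps_has_sum f A t \<Longrightarrow> s = t"
  by (rule mfps_eqI) (simp add: mfps_has_sum_def)

lemma mfps_has_sum_cong:
  assumes "\<And>i. i \<in> A \<Longrightarrow> f i = g i"
  shows "mfps_has_sum f A s \<longleftrightarrow> mfps_has_sum g A s"
proof -
  have "{i \<in> A. mfps_coeff (f i) m \<noteq> 0} = {i \<in> A. mfps_coeff (g i) m \<noteq> 0}" for m
    using assms by auto
  then show ?thesis
    unfolding mfps_has_sum_def using assms by (auto intro!: sum.cong)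
qed

lemma mfps_has_sum_neutral:
  assumes "mfps_has_sum f B s" "B \<subseteq> A" "\<And>i. i \<in> A - B \<Longrightarrow> f i = 0"
  shows "mfps_has_sum f A s"
proof -
  have "{i \<in> A. mfps_coeff (f i) m \<noteq> 0} = {i \<in> B. mfps_coeff (f i) m \<noteq> 0}" for m
  proof (intro set_eqI iffI)
    fix i assume i: "i \<in> {i \<in> A. mfps_coeff (f i) m \<noteq> 0}"
    then have "i \<in> B" using assms(3)[of i] by (cases "i \<in> B") auto
    then show "i \<in> {i \<in> B. mfps_coeff (f i) m \<noteq> 0}" using i by simp
  qed (use assms(2) in auto)
  then show ?thesis
    using assms(1) by (simp add: mfps_has_sum_def)
qed

lemma mfps_has_sum_finite: "finite A \<Longrightarrow> mfps_has_sum f A (sum f A)"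
  by (rule mfps_has_sumI) (auto simp: mfps_coeff_sum)

lemma mfps_has_sum_insert:
  assumes f: "mfps_has_sum f A s" and x: "x \<notin> A"
  shows "mfps_has_sum f (insert x A) (f x + s)"
proof (rule mfps_has_sumI)
  fix m
  let ?F = "{i \<in> A. mfps_coeff (f i) m \<noteq> 0}"
  have fin: "finite ?F"
    by (rule mfps_has_sum_finite_support[OF f])
  have "mfps_coeff (f x + s) m = (\<Sum>i\<in>insert x ?F. mfps_coeff (f i) m)"
    using mfps_has_sum_coeff[OF f fin, of m] fin x by simp
  then show "\<exists>F. finite F \<and> F \<subseteq> insert x A \<and> (\<forall>i\<in>insert x A - F. mfps_coeff (f i) m = 0) \<and>
      mfps_coeff (f x + s) m = (\<Sum>i\<in>F. mfps_coeff (f i) m)"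
    using fin by (intro exI[of _ "insert x ?F"]) auto
qed

lemma mfps_has_sum_reindex:
  assumes "inj_on h A"
  shows "mfps_has_sum f (h ` A) s \<longleftrightarrow> mfps_has_sum (\<lambda>i. f (h i)) A s"
proof -
  have img: "{i \<in> h ` A. mfps_coeff (f i) m \<noteq> 0} = h ` {i \<in> A. mfps_coeff (f (h i)) m \<noteq> 0}" for m
    by auto
  have inj: "inj_on h {i \<in> A. mfps_coeff (f (h i)) m \<noteq> 0}" for m
    using assms by (rule inj_on_subset) auto
  show ?thesis
    unfolding mfps_has_sum_def img
    by (simp add: finite_image_iff[OF inj] sum.reindex[OF inj])
qed

text \<open>A monomial has only finitely many factorisations, so finite index sets \<open>F\<close>
  and \<open>G\<close> account for all terms that reach its coefficient, and the claim reduces to a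
  product of two finite sums.\<close>

lemma mfps_has_sum_mult:
  fixes f :: "'i \<Rightarrow> ('v, 'a::comm_ring_1) mfps"
  assumes f: "mfps_has_sum f A s" and g: "mfps_has_sum g B t"
  shows "mfps_has_sum (\<lambda>(i, j). f i * g j) (A \<times> B) (s * t)"
proof (rule mfps_has_sumI)
  fix m :: "'v \<Rightarrow>\<^sub>0 nat"
  let ?M = "{(a, b). a + b = m}"
  define F where "F = (\<Union>p\<in>?M. {i \<in> A. mfps_coeff (f i) (fst p) \<noteq> 0})"
  define G where "G = (\<Union>p\<in>?M. {j \<in> B. mfps_coeff (g j) (snd p) \<noteq> 0})"
  have fin: "finite F" "finite G"
    unfolding F_def G_def using f g
    by (auto intro!: finite_monomial_splits mfps_has_sum_finite_support)
  have sub: "F \<subseteq> A" "G \<subseteq> B"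
    by (auto simp: F_def G_def)
  have cs: "mfps_coeff s a = (\<Sum>i\<in>F. mfps_coeff (f i) a)" if "a + b = m" for a b
    using that by (intro mfps_has_sum_coeff[OF f] fin sub) (force simp: F_def)
  have ct: "mfps_coeff t b = (\<Sum>j\<in>G. mfps_coeff (g j) b)" if "a + b = m" for a b
    using that by (intro mfps_has_sum_coeff[OF g] fin sub) (force simp: G_def)
  have "mfps_coeff (s * t) m = mfps_coeff ((\<Sum>i\<in>F. f i) * (\<Sum>j\<in>G. g j)) m"
    unfolding mfps_coeff_mult by (rule sum.cong) (auto simp: cs ct mfps_coeff_sum)
  also have "\<dots> = (\<Sum>p\<in>F \<times> G. mfps_coeff (case p of (i, j) \<Rightarrow> f i * g j) m)"
    by (simp add: sum_product mfps_coeff_sum sum.cartesian_product case_prod_unfold)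
  finally have eq: "mfps_coeff (s * t) m =
      (\<Sum>p\<in>F \<times> G. mfps_coeff (case p of (i, j) \<Rightarrow> f i * g j) m)" .
  have "mfps_coeff (f i * g j) m = 0" if "i \<in> A" "j \<in> B" "i \<notin> F \<or> j \<notin> G" for i j
    unfolding mfps_coeff_mult
  proof (rule sum.neutral, safe)
    fix a b assume "m = a + b"
    then show "mfps_coeff (f i) a * mfps_coeff (g j) b = 0"
      using that by (force simp: F_def G_def)
  qed
  then show "\<exists>H. finite H \<and> H \<subseteq> A \<times> B \<and>
      (\<forall>i\<in>A \<times> B - H. mfps_coeff (case i of (i, j) \<Rightarrow> f i * g j) m = 0) \<and>
      mfps_coeff (s * t) m = (\<Sum>i\<in>H. mfps_coeff (case i of (i, j) \<Rightarrow> f i * g j) m)"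
    using fin sub eq by (intro exI[of _ "F \<times> G"]) auto
qed

lemma mfps_has_sum_cmult:
  assumes "mfps_has_sum f A s"
  shows "mfps_has_sum (\<lambda>i. c * f i) A (c * s)"
proof -
  have "mfps_has_sum (\<lambda>(j, i). c * f i) ({()} \<times> A) (c * s)"
    using mfps_has_sum_mult[OF mfps_has_sum_finite[of "{()}" "\<lambda>_. c"] assms] by simp
  moreover have "{()} \<times> A = Pair () ` A" by auto
  ultimately show ?thesis
    by (simp add: mfps_has_sum_reindex inj_on_def)
qed

lemma mfps_has_sum_sum:
  assumes "finite J" "\<And>j. j \<in> J \<Longrightarrow> mfps_has_sum (f j) A (s j)"
  shows "mfps_has_sum (\<lambda>i. \<Sum>j\<in>J. f j i) A (\<Sum>j\<in>J. s j)"
proof (rule mfps_has_sumI)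
  fix m
  define F where "F = (\<Union>j\<in>J. {i \<in> A. mfps_coeff (f j i) m \<noteq> 0})"
  have fin: "finite F" "F \<subseteq> A"
    using assms by (auto simp: F_def intro!: mfps_has_sum_finite_support)
  have "mfps_coeff (s j) m = (\<Sum>i\<in>F. mfps_coeff (f j i) m)" if "j \<in> J" for j
    using that by (intro mfps_has_sum_coeff[OF assms(2)] fin) (auto simp: F_def)
  then have "mfps_coeff (\<Sum>j\<in>J. s j) m = (\<Sum>i\<in>F. mfps_coeff (\<Sum>j\<in>J. f j i) m)"
    unfolding mfps_coeff_sum by (subst sum.swap) (auto intro: sum.cong)
  moreover have "mfps_coeff (\<Sum>j\<in>J. f j i) m = 0" if "i \<in> A - F" for i
    unfolding mfps_coeff_sum using that by (intro sum.neutral) (auto simp: F_def)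
  ultimately show "\<exists>F. finite F \<and> F \<subseteq> A \<and> (\<forall>i\<in>A - F. mfps_coeff (\<Sum>j\<in>J. f j i) m = 0) \<and>
      mfps_coeff (\<Sum>j\<in>J. s j) m = (\<Sum>i\<in>F. mfps_coeff (\<Sum>j\<in>J. f j i) m)"
    using fin by blast
qed

text \<open>Fubini for formal sums. Summability along rows and columns separately is too weak: at
  each monomial the support must be finite as a set of pairs, which confines both summations to
  finite sets.\<close>

lemma mfps_has_sum_swap:
  assumes fin: "\<And>m. finite {(i, j) \<in> A \<times> B. mfps_coeff (h i j) m \<noteq> 0}"
    and f: "\<And>i. i \<in> A \<Longrightarrow> mfps_has_sum (h i) B (f i)"
    and g: "\<And>j. j \<in> B \<Longrightarrow> mfps_has_sum (\<lambda>i. h i j) A (g j)"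
    and s: "mfps_has_sum g B s"
  shows "mfps_has_sum f A s"
proof (rule mfps_has_sumI)
  fix m
  define P where "P = {(i, j) \<in> A \<times> B. mfps_coeff (h i j) m \<noteq> 0}"
  define F where "F = fst ` P"
  define G where "G = snd ` P"
  have FG: "finite F" "finite G" "F \<subseteq> A" "G \<subseteq> B"
    using fin[of m] by (auto simp: F_def G_def P_def)
  have memP: "i \<in> F" "j \<in> G" if "i \<in> A" "j \<in> B" "mfps_coeff (h i j) m \<noteq> 0" for i j
    using that by (force simp: F_def G_def P_def)+
  have cf: "mfps_coeff (f i) m = (\<Sum>j\<in>G. mfps_coeff (h i j) m)" if "i \<in> A" for i
    using that memP by (intro mfps_has_sum_coeff[OF f] FG) auto
  have cg: "mfps_coeff (g j) m = (\<Sum>i\<in>F. mfps_coeff (h i j) m)" if "j \<in> B" for j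
    using that memP by (intro mfps_has_sum_coeff[OF g] FG) auto
  have "mfps_coeff (g j) m = 0" if "j \<in> B - G" for j
    using that memP(2)[of _ j] FG(3) by (subst cg) (blast intro: sum.neutral)+
  then have "mfps_coeff s m = (\<Sum>j\<in>G. mfps_coeff (g j) m)"
    by (intro mfps_has_sum_coeff[OF s] FG) auto
  also have "\<dots> = (\<Sum>j\<in>G. \<Sum>i\<in>F. mfps_coeff (h i j) m)"
    using FG by (intro sum.cong cg) auto
  also have "\<dots> = (\<Sum>i\<in>F. \<Sum>j\<in>G. mfps_coeff (h i j) m)"
    by (rule sum.swap)
  also have "\<dots> = (\<Sum>i\<in>F. mfps_coeff (f i) m)"
    using FG by (intro sum.cong cf[symmetric]) auto
  finally have "mfps_coeff s m = (\<Sum>i\<in>F. mfps_coeff (f i) m)" .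
  moreover have "mfps_coeff (f i) m = 0" if "i \<in> A - F" for i
    using that memP(1)[of i] FG(4) by (subst cf) (blast intro: sum.neutral)+
  ultimately show "\<exists>F. finite F \<and> F \<subseteq> A \<and> (\<forall>i\<in>A - F. mfps_coeff (f i) m = 0) \<and>
      mfps_coeff s m = (\<Sum>i\<in>F. mfps_coeff (f i) m)"
    using FG by blast
qed

text \<open>The distributive law, with factors that may be infinite sums. The choice functions
  vanish from \<open>N\<close> on, so that they can be read as sequences of parts padded by
  zeros.\<close>

lemma mfps_has_sum_prod:
  fixes \<phi> :: "nat \<Rightarrow> nat \<Rightarrow> ('v, 'a::comm_ring_1) mfps"
  assumes "\<And>i. i < N \<Longrightarrow> mfps_has_sum (\<phi> i) (B i) (L i)"
  shows "mfps_has_sum (\<lambda>f. \<Prod>i<N. \<phi> i (f i))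
    {f. (\<forall>i<N. f i \<in> B i) \<and> (\<forall>i\<ge>N. f i = 0)} (\<Prod>i<N. L i)"
  using assms
proof (induction N)
  case 0
  have "{f :: nat \<Rightarrow> nat. \<forall>i. f i = 0} = {\<lambda>_. 0}" by auto
  then show ?case
    using mfps_has_sum_finite[of "{\<lambda>_. 0}" "\<lambda>_. 1 :: ('v, 'a) mfps"] by simp
next
  case (Suc N)
  let ?S = "\<lambda>N. {f. (\<forall>i<N. f i \<in> B i) \<and> (\<forall>i\<ge>N. f i = 0)}"
  let ?h = "\<lambda>(f, k). f(N := k)"
  have "?S (Suc N) \<subseteq> ?h ` (?S N \<times> B N)"
  proof
    fix f assume "f \<in> ?S (Suc N)"
    then have "(f(N := 0), f N) \<in> ?S N \<times> B N" "f = ?h (f(N := 0), f N)"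
      by (auto simp: Suc_le_eq)
    then show "f \<in> ?h ` (?S N \<times> B N)" by blast
  qed
  moreover have "?h ` (?S N \<times> B N) \<subseteq> ?S (Suc N)"
    by (auto simp: less_Suc_eq)
  ultimately have img: "?S (Suc N) = ?h ` (?S N \<times> B N)" by (rule subset_antisym)
  have inj: "inj_on ?h (?S N \<times> B N)"
  proof (rule inj_onI, clarify)
    fix f g :: "nat \<Rightarrow> nat" and k l
    assume z: "\<forall>i\<ge>N. f i = 0" "\<forall>i\<ge>N. g i = 0" and eq: "f(N := k) = g(N := l)"
    have "f i = g i" for i
      using fun_cong[OF eq, of i] z by (cases "i = N") auto
    then show "f = g \<and> k = l"
      using fun_cong[OF eq, of N] by auto
  qed
  have eq: "(\<Prod>i<Suc N. \<phi> i ((f(N := k)) i)) = (\<Prod>i<N. \<phi> i (f i)) * \<phi> N k" for f k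
    by simp
  show ?case
    unfolding img mfps_has_sum_reindex[OF inj]
    using mfps_has_sum_mult[OF Suc.IH Suc.prems[of N]] Suc.prems
    by (simp add: case_prod_unfold)
qed

section \<open>Order of vanishing and geometric series\<close>

definition monomial_degree :: "('v \<Rightarrow>\<^sub>0 nat) \<Rightarrow> nat" where
  "monomial_degree m = (\<Sum>i\<in>Poly_Mapping.keys m. Poly_Mapping.lookup m i)"

text \<open>Total degree in all variables is used; \<open>order_ge 1 f\<close> says that the
  constant term is zero.\<close>

definition order_ge :: "nat \<Rightarrow> ('v, 'a::comm_ring_1) mfps \<Rightarrow> bool" where
  "order_ge k f \<longleftrightarrow> (\<forall>m. monomial_degree m < k \<longrightarrow> mfps_coeff f m = 0)"

lemma monomial_degree_add: "monomial_degree (a + b) = monomial_degree a + monomial_degree b"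
proof -
  let ?K = "Poly_Mapping.keys a \<union> Poly_Mapping.keys b"
  have *: "monomial_degree c = (\<Sum>i\<in>?K. Poly_Mapping.lookup c i)" if "Poly_Mapping.keys c \<subseteq> ?K" for c
    unfolding monomial_degree_def using that
    by (intro sum.mono_neutral_left) (auto simp: in_keys_iff)
  show ?thesis
    using keys_add[of a b] by (simp add: * lookup_add sum.distrib)
qed

lemma order_ge_0 [simp]: "order_ge 0 f"
  by (simp add: order_ge_def)

lemma order_ge_mult: "order_ge k f \<Longrightarrow> order_ge l g \<Longrightarrow> order_ge (k + l) (f * g)"
  unfolding order_ge_def mfps_coeff_mult
proof (intro allI impI sum.neutral, clarify)
  fix a b :: "'a \<Rightarrow>\<^sub>0 nat"
  assume "\<forall>m. monomial_degree m < k \<longrightarrow> mfps_coeff f m = 0"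
    "\<forall>m. monomial_degree m < l \<longrightarrow> mfps_coeff g m = 0" "monomial_degree (a + b) < k + l"
  then show "mfps_coeff f a * mfps_coeff g b = 0"
    by (cases "monomial_degree a < k") (auto simp: monomial_degree_add)
qed

lemma order_ge_power: "order_ge 1 f \<Longrightarrow> order_ge k (f ^ k)"
  by (induction k) (auto dest: order_ge_mult)

lemma order_ge_sum: "(\<And>i. i \<in> A \<Longrightarrow> order_ge k (f i)) \<Longrightarrow> order_ge k (sum f A)"
  by (simp add: order_ge_def mfps_coeff_sum)

lemma order_ge_var: "order_ge 1 (mfps_var v)"
  by (auto simp: order_ge_def mfps_var_def monomial_degree_def)

lemma geometric_series:
  fixes z :: "('v, 'a::comm_ring_1) mfps"
  assumes "order_ge 1 z"
  shows "\<exists>g. mfps_has_sum (\<lambda>k. z ^ k) UNIV g \<and> (1 - z) * g = 1"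
proof -
  \<comment> \<open>\<open>z ^ k\<close> has order at least \<open>k\<close>, so no power beyond the
    degree of \<open>m\<close> reaches the coefficient at \<open>m\<close>.\<close>
  define g where "g = Abs_mfps (\<lambda>m. \<Sum>k\<le>monomial_degree m. mfps_coeff (z ^ k) m)"
  have g: "mfps_has_sum (\<lambda>k. z ^ k) UNIV g"
  proof (rule mfps_has_sumI)
    fix m
    show "\<exists>F. finite F \<and> F \<subseteq> UNIV \<and> (\<forall>k\<in>UNIV - F. mfps_coeff (z ^ k) m = 0) \<and>
        mfps_coeff g m = (\<Sum>k\<in>F. mfps_coeff (z ^ k) m)"
      using order_ge_power[OF assms]
      by (intro exI[of _ "{..monomial_degree m}"]) (auto simp: g_def order_ge_def)
  qed
  \<comment> \<open>Multiplication by \<open>z\<close> shifts the exponents; adding the term for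
    exponent 0 restores the series, and uniqueness of sums gives
    \<open>g = 1 + z * g\<close>.\<close>
  have sg: "mfps_has_sum (\<lambda>k. z ^ k) (range Suc) (z * g)"
    using mfps_has_sum_cmult[OF g, of z] by (subst mfps_has_sum_reindex) simp_all
  have "mfps_has_sum (\<lambda>k. z ^ k) (insert 0 (range Suc)) (z ^ 0 + z * g)"
    by (rule mfps_has_sum_insert[OF sg]) auto
  moreover have "insert 0 (range Suc) = UNIV"
    using not0_implies_Suc by auto
  ultimately have "mfps_has_sum (\<lambda>k. z ^ k) UNIV (1 + z * g)"
    by simp
  then have "g = 1 + z * g"
    using g mfps_has_sum_unique by blast
  then have "g - z * g = 1"
    by (metis add_diff_cancel_right')
  then have "(1 - z) * g = 1"
    by (simp add: left_diff_distrib)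
  then show ?thesis using g by blast
qed

lemma mult_inverse_one_minus:
  fixes z :: "('v, 'a::comm_ring_1) mfps"
  assumes "order_ge 1 z"
  shows "(1 - z) * inverse (1 - z) = 1"
  using geometric_series[OF assms] mfps_inverse_unique by metis

lemma mfps_const_add: "mfps_const (a + b) = mfps_const a + mfps_const b"
  and mfps_const_uminus: "mfps_const (- a) = - mfps_const a"
  by (rule mfps_eqI, simp add: mfps_const_def)+

section \<open>One row at a time\<close>

text \<open>
  \<open>lower_row d a l\<close> is the contribution to the dual weight of a row occupying the columns
  \<open>a, \<dots>, l - 1\<close> below a row that starts in column \<open>d\<close>.
\<close>

locale dual_rows =
  fixes \<alpha> \<beta> y :: "'a::comm_ring_1"
begin

abbreviation s where "s \<equiv> \<alpha> + \<beta>"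
abbreviation t where "t \<equiv> \<alpha> + y"

text \<open>A row that starts a component: \<open>y\<close> for the component and \<open>t\<close>
  for each column after the first. An empty row has weight 1.\<close>

definition top_row :: "nat \<Rightarrow> nat \<Rightarrow> 'a" where
  "top_row a l = (if a < l then y * t ^ (l - a - 1) else 1)"

definition lower_row :: "nat \<Rightarrow> nat \<Rightarrow> nat \<Rightarrow> 'a" where
  "lower_row d a l = (if l \<le> d then top_row a l else \<beta> * s ^ (l - d - 1) * t ^ (d - a))"

end

text \<open>Here \<open>u\<close> models x / (1 + \<alpha> x) and \<open>e\<close> models 1 +
  \<alpha> x; the equation \<open>unit\<close> relates them without division.\<close>

locale cauchy_weights = dual_rows \<alpha> \<beta> y for \<alpha> \<beta> y :: "'a::comm_ring_1" +
  fixes u e :: 'a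
  assumes unit: "(1 - \<alpha> * u) * e = 1"
begin

abbreviation v where "v \<equiv> 1 - s * u"

text \<open>
  Below, \<open>p = \<mu>\<^sub>i\<^sub>+\<^sub>1\<close>, \<open>q = \<mu>\<^sub>i\<close>, \<open>a = \<nu>\<^sub>i\<^sub>+\<^sub>1\<close>, \<open>d = \<nu>\<^sub>i\<close>; \<open>add_row\<close> sums over \<open>l = \<lambda>\<^sub>i\<^sub>+\<^sub>1\<close> and
  \<open>remove_row\<close> over \<open>k = \<kappa>\<^sub>i\<close>. The dual weight of row \<open>i + 1\<close> of \<open>\<mu>/\<kappa>\<close> involves both
  \<open>\<kappa>\<^sub>i\<close> and \<open>\<kappa>\<^sub>i\<^sub>+\<^sub>1\<close>, but for fixed \<open>\<nu>\<close> it splits into \<open>row_link\<close>, depending on \<open>\<kappa>\<^sub>i\<close>, and \<open>row_end\<close>,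
  depending on \<open>\<kappa>\<^sub>i\<^sub>+\<^sub>1\<close>, because \<open>\<nu>\<^sub>i\<^sub>+\<^sub>1 \<ge> \<mu>\<^sub>i\<^sub>+\<^sub>1\<close> rules out an overlap with row \<open>i\<close> and
  \<open>\<nu>\<^sub>i\<^sub>+\<^sub>1 < \<mu>\<^sub>i\<^sub>+\<^sub>1\<close> forces row \<open>i + 1\<close> to be nonempty.
\<close>

definition add_row :: "nat \<Rightarrow> nat \<Rightarrow> nat \<Rightarrow> nat \<Rightarrow> 'a" where
  "add_row p q a d =
    (\<Sum>l = max p a..q. u ^ (l - p) * (if l < q then v else 1) * lower_row d a l)"

definition row_end :: "nat \<Rightarrow> nat \<Rightarrow> nat \<Rightarrow> 'a" where
  "row_end d q k = (if d < q then t ^ (d - k) else top_row k q)"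

definition row_link :: "nat \<Rightarrow> nat \<Rightarrow> nat \<Rightarrow> 'a" where
  "row_link a p k = (if a < p then (if k < p then \<beta> * s ^ (p - k - 1) * t ^ (k - a) else top_row a p) else 1)"

definition remove_row :: "nat \<Rightarrow> nat \<Rightarrow> nat \<Rightarrow> nat \<Rightarrow> 'a" where
  "remove_row p q a d =
    (\<Sum>k = a..min d q. u ^ (d - k) * (if a < k then v else 1) * (row_end d q k * row_link a p k))"

text \<open>The potential of the coboundary by which \<open>add_row\<close> and
  \<open>remove_row\<close> differ. Its powers of \<open>u\<close> reconcile exponents measured from
  different ends; \<open>e\<close> undoes the factor 1 - \<alpha> u of the mixed cases.\<close>

definition cocycle :: "nat \<Rightarrow> nat \<Rightarrow> 'a" where
  "cocycle d q = (if q \<le> d then u ^ (d - q) else e)"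

text \<open>Since \<open>v = 1 - s * u\<close>, each term with the factor \<open>v\<close> is a
  difference of consecutive powers of \<open>s * u\<close>; the last term, without this factor,
  supplies the power left over.\<close>

lemma telescope_up:
  assumes "m \<le> n"
  shows "(\<Sum>l = m..n. (s * u) ^ (l - m) * (if l < n then v else 1)) = 1"
  using assms
proof (induction n rule: dec_induct)
  case base
  then show ?case by simp
next
  case (step n)
  have "(\<Sum>l = m..Suc n. (s * u) ^ (l - m) * (if l < Suc n then v else 1))
      = (\<Sum>l = m..n. (s * u) ^ (l - m) * v) + (s * u) ^ (Suc n - m)"
    using step by simp
  also have "(\<Sum>l = m..n. (s * u) ^ (l - m) * v)
      = (\<Sum>l = m..<n. (s * u) ^ (l - m) * v) + (s * u) ^ (n - m) * v"
    using step by (simp add: sum.last_plus add.commute)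
  also have "(\<Sum>l = m..<n. (s * u) ^ (l - m) * v) = 1 - (s * u) ^ (n - m)"
    using step by (simp add: sum.last_plus algebra_simps)
  finally show ?case
    using step by (simp add: Suc_diff_le algebra_simps)
qed

lemma telescope_down:
  assumes "m \<le> n"
  shows "(\<Sum>k = m..n. (s * u) ^ (n - k) * (if m < k then v else 1)) = 1"
proof -
  have "(\<Sum>k = m..n. (s * u) ^ (n - k) * (if m < k then v else 1))
      = (\<Sum>l = m..n. (s * u) ^ (l - m) * (if l < n then v else 1))"
    by (rule sum.reindex_bij_witness[of _ "\<lambda>l. m + n - l" "\<lambda>l. m + n - l"]) (auto)
  then show ?thesis using telescope_up[OF assms] by simp
qed

definition geom :: "nat \<Rightarrow> 'a" where
  "geom N = (\<Sum>j<N. (u * t) ^ j)"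

text \<open>Up to common factors, \<open>v * geom N + (u * t) ^ N\<close> and the right-hand side
  are closed forms of the two row sums when exactly one of \<open>a < p\<close> and
  \<open>d < q\<close> holds; this is the source of \<open>e\<close>. It follows from the finite
  geometric sum and u y = u t - \<alpha> u.\<close>

lemma geom_sum_unit_factor:
  "(1 - \<alpha> * u) * (v * geom N + (u * t) ^ N) = v * (1 + u * y * geom N) + \<beta> * u * (u * t) ^ N"
proof -
  define X where "X = (u * t) ^ N"
  have "u * t * geom N = geom N + X - 1"
    using power_diff_1_eq[of "u * t" N] by (simp add: geom_def X_def algebra_simps)
  then have "u * y * geom N = geom N + X - 1 - \<alpha> * u * geom N"
    by (simp add: algebra_simps)
  then have "v * (1 + u * y * geom N) + \<beta> * u * X = v * (geom N + X - \<alpha> * u * geom N) + \<beta> * u * X"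
    by (simp add: add_diff_eq)
  also have "\<dots> = (1 - \<alpha> * u) * (v * geom N + X)"
    by (simp add: algebra_simps)
  finally show ?thesis by (simp add: X_def)
qed

section \<open>The row identity in four cases; the names place first \<open>a\<close> relative to
  \<open>p\<close>, then \<open>d\<close> relative to \<open>q\<close>\<close>

lemma add_row_above_above:
  assumes "p \<le> a" "q \<le> d" "a \<le> q"
  shows "add_row p q a d * u ^ (d - q) = remove_row p q a d * u ^ (a - p)"
proof -
  have "add_row p q a d * u ^ (d - q) =
      (\<Sum>l = a..q. u ^ (l - p) * (if l < q then v else 1) * top_row a l * u ^ (d - q))"
    using assms by (simp add: add_row_def lower_row_def max_absorb2 sum_distrib_right)
  also have "\<dots> = (\<Sum>k = a..q. u ^ (d - k) * (if a < k then v else 1) * top_row k q * u ^ (a - p))"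
  \<comment> \<open>Reflection of the range: \<open>l\<close> and \<open>k = a + q - l\<close> have
    equal row lengths \<open>l - a = q - k\<close>, and the exceptional end \<open>l = q\<close>
    goes to \<open>k = a\<close>.\<close>
  proof (rule sum.reindex_bij_witness[of _ "\<lambda>k. a + q - k" "\<lambda>k. a + q - k"], goal_cases)
    case (5 l)
    then have "(d - (a + q - l)) + (a - p) = (l - p) + (d - q)"
      using assms by auto
    then have "u ^ (d - (a + q - l)) * u ^ (a - p) = u ^ (l - p) * u ^ (d - q)"
      by (simp flip: power_add)
    then have "X * u ^ (d - (a + q - l)) * u ^ (a - p) = X * u ^ (l - p) * u ^ (d - q)" for X
      by (simp add: mult.assoc)
    from this[of "(if l < q then v else 1) * top_row a l"] show ?case
      using 5 assms by (auto simp: top_row_def mult_ac)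
  qed (use assms in auto)
  also have "\<dots> = remove_row p q a d * u ^ (a - p)"
    using assms by (simp add: remove_row_def row_end_def row_link_def min_absorb2 sum_distrib_right)
  finally show ?thesis .
qed

text \<open>Removal gives a geometric sum in \<open>u * t\<close>. The three kinds of added rows
  (empty, not reaching past \<open>d\<close>, overlapping the row above) add up to the other side of
  \<open>geom_sum_unit_factor\<close>.\<close>

lemma add_row_above_below:
  assumes "p \<le> a" "d < q" "a \<le> d"
  shows "add_row p q a d * e = remove_row p q a d * u ^ (a - p)"
proof -
  define D where "D = d - a"
  have split: "{a..q} = insert a ({Suc a..d} \<union> {Suc d..q})" using assms by auto
  have "add_row p q a d = (\<Sum>l = a..q. u ^ (a - p) * (u ^ (l - a) * (if l < q then v else 1) * lower_row d a l))"
    unfolding add_row_def max_absorb2[OF assms(1)]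
  proof (rule sum.cong)
    fix l assume "l \<in> {a..q}"
    then have "u ^ (l - p) = u ^ (a - p) * u ^ (l - a)"
      using assms by (simp flip: power_add)
    then show "u ^ (l - p) * (if l < q then v else 1) * lower_row d a l =
        u ^ (a - p) * (u ^ (l - a) * (if l < q then v else 1) * lower_row d a l)"
      by (simp add: mult.assoc)
  qed simp
  also have "\<dots> = u ^ (a - p) * (\<Sum>l = a..q. u ^ (l - a) * (if l < q then v else 1) * lower_row d a l)"
    by (simp add: sum_distrib_left)
  also have "(\<Sum>l = a..q. u ^ (l - a) * (if l < q then v else 1) * lower_row d a l) =
      v + (\<Sum>l = Suc a..d. u ^ (l - a) * v * (y * t ^ (l - a - 1)))
        + (\<Sum>l = Suc d..q. u ^ (l - a) * (if l < q then v else 1) * (\<beta> * s ^ (l - d - 1) * t ^ (d - a)))"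
    unfolding split using assms
    by (simp add: sum.union_disjoint lower_row_def top_row_def add.assoc)
  also have "(\<Sum>l = Suc a..d. u ^ (l - a) * v * (y * t ^ (l - a - 1))) =
      (\<Sum>j<D. v * u * y * (u * t) ^ j)"
  proof (rule sum.reindex_bij_witness[of _ "\<lambda>j. j + Suc a" "\<lambda>l. l - Suc a"], goal_cases)
    case (5 l)
    then have "l - a = Suc (l - Suc a)" by auto
    then show ?case by (simp add: power_mult_distrib mult_ac)
  qed (auto simp: D_def)
  also have "\<dots> = v * u * y * geom D"
    by (simp add: geom_def sum_distrib_left)
  \<comment> \<open>Each further overlapping column contributes \<open>s * u\<close>, so this range
    telescopes to its leading constant.\<close>
  also have "(\<Sum>l = Suc d..q. u ^ (l - a) * (if l < q then v else 1) * (\<beta> * s ^ (l - d - 1) * t ^ (d - a))) =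
      (\<Sum>l = Suc d..q. (\<beta> * u * (u * t) ^ D) * ((s * u) ^ (l - Suc d) * (if l < q then v else 1)))"
  proof (rule sum.cong)
    fix l assume "l \<in> {Suc d..q}"
    then have "l - a = (l - Suc d) + Suc D" using assms by (auto simp: D_def)
    then have "u ^ (l - a) = u ^ (l - Suc d) * u * u ^ D" by (simp add: power_add mult_ac)
    then show "u ^ (l - a) * (if l < q then v else 1) * (\<beta> * s ^ (l - d - 1) * t ^ (d - a)) =
        (\<beta> * u * (u * t) ^ D) * ((s * u) ^ (l - Suc d) * (if l < q then v else 1))"
      by (simp add: power_mult_distrib mult_ac flip: D_def)
  qed simp
  also have "\<dots> = \<beta> * u * (u * t) ^ D"
    using assms by (simp only: sum_distrib_left[symmetric] telescope_up) simp
  finally have L: "add_row p q a d = u ^ (a - p) * (v * (1 + u * y * geom D) + \<beta> * u * (u * t) ^ D)"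
    by (simp only: distrib_left mult_1_right mult.assoc)
  have "remove_row p q a d = (\<Sum>k = a..d. (u * t) ^ (d - k) * (if a < k then v else 1))"
    using assms by (simp add: remove_row_def row_end_def row_link_def power_mult_distrib mult_ac)
  also have "\<dots> = (\<Sum>j<Suc D. (u * t) ^ j * (if j < D then v else 1))"
    using assms
    by (intro sum.reindex_bij_witness[of _ "\<lambda>j. d - j" "\<lambda>k. d - k"]) (auto simp: D_def)
  also have "\<dots> = v * geom D + (u * t) ^ D"
    by (simp add: geom_def sum_distrib_left mult.commute)
  finally have R: "remove_row p q a d = v * geom D + (u * t) ^ D" .
  have "add_row p q a d * e = ((1 - \<alpha> * u) * e) * (remove_row p q a d * u ^ (a - p))"
    unfolding L R geom_sum_unit_factor[symmetric] by (simp only: mult_ac)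
  then show ?thesis by (simp add: unit)
qed

text \<open>The mirror image of \<open>add_row_above_below\<close>: now the added rows form the
  geometric sum, and the removed ones split at \<open>p\<close> into linked and unlinked ones, with
  the empty row \<open>k = q\<close> apart.\<close>

lemma add_row_below_above:
  assumes "a < p" "q \<le> d" "p \<le> q"
  shows "add_row p q a d * u ^ (d - q) = remove_row p q a d * e"
proof -
  define N where "N = q - p"
  have "add_row p q a d = (\<Sum>l = p..q. top_row a p * ((u * t) ^ (l - p) * (if l < q then v else 1)))"
    unfolding add_row_def max_absorb1[OF less_imp_le[OF assms(1)]]
  proof (rule sum.cong)
    fix l assume l: "l \<in> {p..q}"
    then have "l - a - 1 = (p - a - 1) + (l - p)" using assms by auto
    then have "t ^ (l - a - 1) = t ^ (p - a - 1) * t ^ (l - p)" by (simp only: power_add)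
    then show "u ^ (l - p) * (if l < q then v else 1) * lower_row d a l =
        top_row a p * ((u * t) ^ (l - p) * (if l < q then v else 1))"
      using l assms by (simp add: lower_row_def top_row_def power_mult_distrib mult_ac)
  qed simp
  also have "\<dots> = top_row a p * (\<Sum>l = p..q. (u * t) ^ (l - p) * (if l < q then v else 1))"
    by (simp only: sum_distrib_left)
  also have "(\<Sum>l = p..q. (u * t) ^ (l - p) * (if l < q then v else 1)) =
      (\<Sum>j<Suc N. (u * t) ^ j * (if j < N then v else 1))"
    using assms
    by (intro sum.reindex_bij_witness[of _ "\<lambda>j. j + p" "\<lambda>l. l - p"]) (auto simp: N_def)
  also have "\<dots> = v * geom N + (u * t) ^ N"
    by (simp add: geom_def sum_distrib_left mult.commute)
  finally have L: "add_row p q a d = top_row a p * (v * geom N + (u * t) ^ N)" .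
  have split: "{a..q} = {a..p - 1} \<union> ({p..<q} \<union> {q})" using assms by auto
  have "remove_row p q a d = (\<Sum>k = a..q. u ^ (d - q) * (u ^ (q - k) *
      (if a < k then v else 1) * (top_row k q * row_link a p k)))"
    unfolding remove_row_def min_absorb2[OF assms(2)]
  proof (rule sum.cong)
    fix k assume "k \<in> {a..q}"
    then have "u ^ (d - k) = u ^ (d - q) * u ^ (q - k)"
      using assms by (simp flip: power_add)
    then show "u ^ (d - k) * (if a < k then v else 1) * (row_end d q k * row_link a p k) =
        u ^ (d - q) * (u ^ (q - k) * (if a < k then v else 1) * (top_row k q * row_link a p k))"
      using assms by (simp add: row_end_def mult.assoc)
  qed simp
  also have "\<dots> = u ^ (d - q) * (\<Sum>k = a..q. u ^ (q - k) *
      (if a < k then v else 1) * (top_row k q * row_link a p k))"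
    by (simp only: sum_distrib_left)
  also have "(\<Sum>k = a..q. u ^ (q - k) * (if a < k then v else 1) * (top_row k q * row_link a p k)) =
      (\<Sum>k = a..p - 1. u ^ (q - k) * (if a < k then v else 1) *
         (y * t ^ (q - k - 1) * (\<beta> * s ^ (p - k - 1) * t ^ (k - a))))
      + ((\<Sum>k = p..<q. u ^ (q - k) * v * (y * t ^ (q - k - 1) * top_row a p)) + v * top_row a p)"
  proof -
    have "(\<Sum>k = a..p - 1. u ^ (q - k) * (if a < k then v else 1) * (top_row k q * row_link a p k)) =
      (\<Sum>k = a..p - 1. u ^ (q - k) * (if a < k then v else 1) *
         (y * t ^ (q - k - 1) * (\<beta> * s ^ (p - k - 1) * t ^ (k - a))))"
      using assms by (intro sum.cong) (auto simp: top_row_def row_link_def)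
    moreover have "(\<Sum>k = p..<q. u ^ (q - k) * (if a < k then v else 1) * (top_row k q * row_link a p k)) =
      (\<Sum>k = p..<q. u ^ (q - k) * v * (y * t ^ (q - k - 1) * top_row a p))"
      using assms by (intro sum.cong) (auto simp: top_row_def row_link_def)
    moreover have "top_row q q = 1" "row_link a p q = top_row a p" "a < q"
      using assms by (auto simp: top_row_def row_link_def)
    ultimately show ?thesis
      unfolding split using assms by (subst sum.union_disjoint; (subst sum.union_disjoint)?) auto
  qed
  \<comment> \<open>The overlap grows as \<open>k\<close> decreases from \<open>p - 1\<close>, and
    the end \<open>k = a\<close>, without the factor \<open>v\<close>, closes the telescope.\<close>
  also have "(\<Sum>k = a..p - 1. u ^ (q - k) * (if a < k then v else 1) *
         (y * t ^ (q - k - 1) * (\<beta> * s ^ (p - k - 1) * t ^ (k - a)))) =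
      (\<Sum>k = a..p - 1. (top_row a p * \<beta> * u * (u * t) ^ N) * ((s * u) ^ (p - 1 - k) * (if a < k then v else 1)))"
  proof (rule sum.cong)
    fix k assume k: "k \<in> {a..p - 1}"
    then have kq: "q - k = (p - 1 - k) + Suc N" "(q - k - 1) + (k - a) = (p - a - 1) + N"
      using assms by (auto simp: N_def)
    have 1: "u ^ (q - k) = u ^ (p - 1 - k) * u * u ^ N"
      "t ^ (q - k - 1) * t ^ (k - a) = t ^ (p - a - 1) * t ^ N"
      by (simp add: kq(1) power_add mult_ac) (simp only: power_add[symmetric] kq(2))
    have "u ^ (q - k) * (if a < k then v else 1) * (y * t ^ (q - k - 1) * (\<beta> * s ^ (p - k - 1) * t ^ (k - a)))
      = u ^ (q - k) * (if a < k then v else 1) * (y * \<beta> * s ^ (p - k - 1) * (t ^ (q - k - 1) * t ^ (k - a)))"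
      by (simp only: mult_ac)
    also have "\<dots> = (top_row a p * \<beta> * u * (u * t) ^ N) * ((s * u) ^ (p - 1 - k) * (if a < k then v else 1))"
      unfolding 1 using k assms by (simp add: top_row_def power_mult_distrib mult_ac)
    finally show "u ^ (q - k) * (if a < k then v else 1) * (y * t ^ (q - k - 1) * (\<beta> * s ^ (p - k - 1) * t ^ (k - a)))
      = (top_row a p * \<beta> * u * (u * t) ^ N) * ((s * u) ^ (p - 1 - k) * (if a < k then v else 1))" .
  qed simp
  also have "\<dots> = top_row a p * \<beta> * u * (u * t) ^ N"
    using assms by (simp only: sum_distrib_left[symmetric]) (subst telescope_down, auto)
  also have "(\<Sum>k = p..<q. u ^ (q - k) * v * (y * t ^ (q - k - 1) * top_row a p)) =
      (\<Sum>j<N. top_row a p * v * u * y * (u * t) ^ j)"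
  proof (rule sum.reindex_bij_witness[of _ "\<lambda>j. q - Suc j" "\<lambda>k. q - Suc k"], goal_cases)
    case (5 k)
    then have "q - k = Suc (q - Suc k)" by auto
    then show ?case by (simp add: power_mult_distrib mult_ac)
  qed (auto simp: N_def)
  also have "\<dots> = top_row a p * v * u * y * geom N"
    by (simp add: geom_def sum_distrib_left)
  finally have R: "remove_row p q a d =
      u ^ (d - q) * (top_row a p * (v * (1 + u * y * geom N) + \<beta> * u * (u * t) ^ N))"
    by (simp only: distrib_left mult_1_right mult_1_left mult_ac add_ac)
  have "remove_row p q a d * e = ((1 - \<alpha> * u) * e) * (add_row p q a d * u ^ (d - q))"
    unfolding L R geom_sum_unit_factor[symmetric] by (simp only: mult_ac)
  then show ?thesis by (simp add: unit)
qed

text \<open>Both cocycle values are \<open>e\<close> here, so the sums have to agree exactly. The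
  unlinked terms, present if \<open>p \<le> d\<close>, match under reflection; the linked terms
  telescope to the same constant on both sides.\<close>

lemma add_row_below_below:
  assumes "a < p" "d < q" "a \<le> d" "p \<le> q"
  shows "add_row p q a d = remove_row p q a d"
proof (cases "p \<le> d")
  case True
  have split: "{p..q} = {p..d} \<union> {Suc d..q}" "{a..d} = {a..p - 1} \<union> {p..d}"
    using True assms by auto
  have "add_row p q a d =
      (\<Sum>l = p..d. u ^ (l - p) * v * (y * t ^ (l - a - 1)))
      + (\<Sum>l = Suc d..q. u ^ (l - p) * (if l < q then v else 1) * (\<beta> * s ^ (l - d - 1) * t ^ (d - a)))"
    unfolding add_row_def max_absorb1[OF less_imp_le[OF assms(1)]] split(1)
    using assms by (subst sum.union_disjoint) (auto simp: lower_row_def top_row_def intro!: sum.cong)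
  also have "(\<Sum>l = Suc d..q. u ^ (l - p) * (if l < q then v else 1) * (\<beta> * s ^ (l - d - 1) * t ^ (d - a))) =
      (\<Sum>l = Suc d..q. (\<beta> * t ^ (d - a) * u ^ (Suc d - p)) * ((s * u) ^ (l - Suc d) * (if l < q then v else 1)))"
  proof (rule sum.cong)
    fix l assume "l \<in> {Suc d..q}"
    then have "l - p = (l - Suc d) + (Suc d - p)" using True by auto
    then have 1: "u ^ (l - p) = u ^ (l - Suc d) * u ^ (Suc d - p)" by (simp only: power_add)
    show "u ^ (l - p) * (if l < q then v else 1) * (\<beta> * s ^ (l - d - 1) * t ^ (d - a)) =
        (\<beta> * t ^ (d - a) * u ^ (Suc d - p)) * ((s * u) ^ (l - Suc d) * (if l < q then v else 1))"
      unfolding 1 by (simp add: power_mult_distrib mult_ac)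
  qed simp
  also have "\<dots> = \<beta> * t ^ (d - a) * u ^ (Suc d - p)"
    using assms by (simp only: sum_distrib_left[symmetric]) (subst telescope_up, auto)
  finally have L: "add_row p q a d = (\<Sum>l = p..d. u ^ (l - p) * v * (y * t ^ (l - a - 1)))
      + \<beta> * t ^ (d - a) * u ^ (Suc d - p)" .
  have "remove_row p q a d =
      (\<Sum>k = a..p - 1. u ^ (d - k) * (if a < k then v else 1) * (t ^ (d - k) * (\<beta> * s ^ (p - k - 1) * t ^ (k - a))))
      + (\<Sum>k = p..d. u ^ (d - k) * v * (t ^ (d - k) * (y * t ^ (p - a - 1))))"
    unfolding remove_row_def min_absorb1[OF less_imp_le[OF assms(2)]] split(2)
    using assms by (subst sum.union_disjoint)
      (auto simp: row_end_def row_link_def top_row_def intro!: sum.cong arg_cong2[of _ _ _ _ "(+)"])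
  also have "(\<Sum>k = p..d. u ^ (d - k) * v * (t ^ (d - k) * (y * t ^ (p - a - 1)))) =
      (\<Sum>l = p..d. u ^ (l - p) * v * (y * t ^ (l - a - 1)))"
  proof (rule sum.reindex_bij_witness[of _ "\<lambda>k. p + d - k" "\<lambda>k. p + d - k"], goal_cases)
    case (5 k)
    then have "p + d - k - a - 1 = (d - k) + (p - a - 1)" "p + d - k - p = d - k"
      using assms by auto
    then show ?case by (simp only: power_add mult_ac)
  qed auto
  also have "(\<Sum>k = a..p - 1. u ^ (d - k) * (if a < k then v else 1) * (t ^ (d - k) * (\<beta> * s ^ (p - k - 1) * t ^ (k - a)))) =
      (\<Sum>k = a..p - 1. (\<beta> * t ^ (d - a) * u ^ (Suc d - p)) * ((s * u) ^ (p - 1 - k) * (if a < k then v else 1)))"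
  proof (rule sum.cong)
    fix k assume k: "k \<in> {a..p - 1}"
    then have "d - k = (p - 1 - k) + (Suc d - p)" "d - a = (d - k) + (k - a)"
      using assms True by auto
    then have 1: "u ^ (d - k) = u ^ (p - 1 - k) * u ^ (Suc d - p)" "t ^ (d - a) = t ^ (d - k) * t ^ (k - a)"
      by (simp_all only: power_add)
    have 2: "p - k - 1 = p - 1 - k" by simp
    show "u ^ (d - k) * (if a < k then v else 1) * (t ^ (d - k) * (\<beta> * s ^ (p - k - 1) * t ^ (k - a))) =
        (\<beta> * t ^ (d - a) * u ^ (Suc d - p)) * ((s * u) ^ (p - 1 - k) * (if a < k then v else 1))"
      unfolding 1 2 by (simp only: power_mult_distrib mult_ac)
  qed simp
  also have "\<dots> = \<beta> * t ^ (d - a) * u ^ (Suc d - p)"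
    using assms by (simp only: sum_distrib_left[symmetric]) (subst telescope_down, auto)
  finally show ?thesis using L by (simp only: add.commute)
next
  case False
  \<comment> \<open>Now \<open>d < p\<close>, so every term is linked. Apart from \<open>v\<close>,
    this is the term at \<open>l = p\<close> on one side and at \<open>k = d\<close> on the
    other.\<close>
  let ?c = "\<beta> * t ^ (d - a) * s ^ (p - Suc d)"
  have "add_row p q a d = (\<Sum>l = p..q. ?c * ((s * u) ^ (l - p) * (if l < q then v else 1)))"
    unfolding add_row_def max_absorb1[OF less_imp_le[OF assms(1)]]
  proof (rule sum.cong)
    fix l assume l: "l \<in> {p..q}"
    then have "l - d - 1 = (p - Suc d) + (l - p)" using False by auto
    then have "s ^ (l - d - 1) = s ^ (p - Suc d) * s ^ (l - p)" by (simp only: power_add)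
    then show "u ^ (l - p) * (if l < q then v else 1) * lower_row d a l =
        ?c * ((s * u) ^ (l - p) * (if l < q then v else 1))"
      using l False by (simp add: lower_row_def power_mult_distrib mult_ac)
  qed simp
  also have "\<dots> = ?c"
    using assms by (simp only: sum_distrib_left[symmetric] telescope_up) simp
  finally have L: "add_row p q a d = ?c" .
  have "remove_row p q a d = (\<Sum>k = a..d. ?c * ((s * u) ^ (d - k) * (if a < k then v else 1)))"
    unfolding remove_row_def min_absorb1[OF less_imp_le[OF assms(2)]]
  proof (rule sum.cong)
    fix k assume k: "k \<in> {a..d}"
    then have "p - k - 1 = (p - Suc d) + (d - k)" "d - a = (d - k) + (k - a)" using False by auto
    then have "s ^ (p - k - 1) = s ^ (p - Suc d) * s ^ (d - k)" "t ^ (d - a) = t ^ (d - k) * t ^ (k - a)"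
      by (simp_all only: power_add)
    then show "u ^ (d - k) * (if a < k then v else 1) * (row_end d q k * row_link a p k) =
        ?c * ((s * u) ^ (d - k) * (if a < k then v else 1))"
      using k False assms by (simp add: row_end_def row_link_def power_mult_distrib mult_ac)
  qed simp
  also have "\<dots> = ?c"
    using assms by (simp only: sum_distrib_left[symmetric] telescope_down) simp
  finally show ?thesis using L by simp
qed

lemma add_row_remove_row:
  assumes "p \<le> q" "a \<le> d"
  shows "add_row p q a d * cocycle d q = remove_row p q a d * cocycle a p"
proof (cases "a \<le> q")
  case True
  with assms show ?thesis
    using add_row_above_above[of p a q d] add_row_above_below[of p a d q]
      add_row_below_above[of a p q d] add_row_below_below[of a p d q]
    by (cases "p \<le> a"; cases "q \<le> d") (auto simp: cocycle_def not_le)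
\<comment> \<open>If \<open>q < a\<close>, both ranges of summation are empty.\<close>
qed (simp add: add_row_def remove_row_def)

section \<open>Splitting the dual weight and telescoping over rows\<close>

lemma lower_row_split:
  assumes "k' \<le> a" "a \<le> k" "k' \<le> p"
  shows "lower_row k k' p = row_end a p k' * row_link a p k"
proof (cases "a < p")
  case True
  show ?thesis
  proof (cases "k < p")
    case k: True
    have "k - k' = (a - k') + (k - a)" using assms by simp
    then have "t ^ (k - k') = t ^ (a - k') * t ^ (k - a)" by (simp only: power_add)
    then show ?thesis using True k by (simp add: lower_row_def row_end_def row_link_def mult_ac)
  next
    case False
    have "p - k' - 1 = (a - k') + (p - a - 1)" using assms True by simp
    then have "t ^ (p - k' - 1) = t ^ (a - k') * t ^ (p - a - 1)" by (simp only: power_add)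
    then show ?thesis
      using True False assms by (simp add: lower_row_def row_end_def row_link_def top_row_def mult_ac)
  qed
next
  case False
  then show ?thesis using assms by (simp add: lower_row_def row_end_def row_link_def)
qed

lemma top_row_split:
  assumes "k \<le> d"
  shows "top_row k q = top_row d q * row_end d q k"
proof (cases "d < q")
  case True
  have "q - k - 1 = (d - k) + (q - d - 1)" using assms True by simp
  then have "t ^ (q - k - 1) = t ^ (d - k) * t ^ (q - d - 1)" by (simp only: power_add)
  then show ?thesis using True assms by (simp add: top_row_def row_end_def mult_ac)
qed (simp add: top_row_def row_end_def)

text \<open>Moving the cocycle past a row turns \<open>add_row\<close> into
  \<open>remove_row\<close>, so only its values at the two ends survive. Once \<open>N\<close> lies
  beyond all parts, the value at \<open>N\<close> is 1.\<close>

lemma prod_add_row: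
  assumes "antimono mu" "antimono nu"
  shows "cocycle (nu 0) (mu 0) * (\<Prod>i<N. add_row (mu (Suc i)) (mu i) (nu (Suc i)) (nu i)) =
    (\<Prod>i<N. remove_row (mu (Suc i)) (mu i) (nu (Suc i)) (nu i)) * cocycle (nu N) (mu N)"
proof (induction N)
  case (Suc N)
  have "add_row (mu (Suc N)) (mu N) (nu (Suc N)) (nu N) * cocycle (nu N) (mu N) =
      remove_row (mu (Suc N)) (mu N) (nu (Suc N)) (nu N) * cocycle (nu (Suc N)) (mu (Suc N))"
    using assms by (intro add_row_remove_row) (auto simp: antimono_def)
  then have "X * cocycle (nu N) (mu N) * add_row (mu (Suc N)) (mu N) (nu (Suc N)) (nu N) =
      X * remove_row (mu (Suc N)) (mu N) (nu (Suc N)) (nu N) * cocycle (nu (Suc N)) (mu (Suc N))" for X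
    by (simp add: mult_ac)
  then show ?case
    by (simp add: mult.assoc[symmetric] Suc.IH)
qed simp

end

section \<open>Skew shapes row by row\<close>

lemma num_rows_skew: "num_rows (skew_cells la mu) = card {i. mu i < la i}"
proof -
  have "fst ` skew_cells la mu = {i. mu i < la i}"
    by (force simp: skew_cells_def image_iff)
  then show ?thesis by (simp add: num_rows_def)
qed

text \<open>
  The row above a row \<open>i > 0\<close> of \<open>\<lambda>/\<mu>\<close> starts in column \<open>row_bound \<lambda> \<mu> i\<close>; the two rows
  overlap in the columns from there on. For \<open>i = 0\<close> the value excludes any overlap.
\<close>

definition row_bound :: "(nat \<Rightarrow> nat) \<Rightarrow> (nat \<Rightarrow> nat) \<Rightarrow> nat \<Rightarrow> nat" where
  "row_bound la mu i = (case i of 0 \<Rightarrow> la 0 | Suc k \<Rightarrow> mu k)"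

lemma row_bound_simps [simp]: "row_bound la mu 0 = la 0" "row_bound la mu (Suc k) = mu k"
  by (simp_all add: row_bound_def)

lemma row_bound_ge: "antimono mu \<Longrightarrow> mu \<le> la \<Longrightarrow> mu i \<le> row_bound la mu i"
  by (cases i) (auto simp: le_fun_def antimono_def)

text \<open>Each column is counted at its topmost cell.\<close>

lemma num_cols_skew:
  assumes "antimono la" "antimono mu"
  shows "num_cols (skew_cells la mu) =
    card (Sigma UNIV (\<lambda>i. {mu i..<min (la i) (row_bound la mu i)}))"
proof -
  define T where "T = Sigma UNIV (\<lambda>i. {mu i..<min (la i) (row_bound la mu i)})"
  have mu: "mu k \<le> mu i" if "i \<le> k" for i k
    using assms(2) that by (auto simp: antimono_def)
  have "snd ` skew_cells la mu \<subseteq> snd ` T"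
  proof
    fix j assume "j \<in> snd ` skew_cells la mu"
    then have ex: "\<exists>i. mu i \<le> j \<and> j < la i" by (auto simp: skew_cells_def)
    define i where "i = (LEAST i. mu i \<le> j \<and> j < la i)"
    have i: "mu i \<le> j" "j < la i"
      using LeastI_ex[OF ex] by (auto simp: i_def)
    have "j < row_bound la mu i"
    proof (cases i)
      case 0
      then show ?thesis using i by simp
    next
      case (Suc k)
      then have "\<not> (mu k \<le> j \<and> j < la k)"
        using not_less_Least[of k "\<lambda>i. mu i \<le> j \<and> j < la i"] by (simp add: i_def)
      moreover have "la i \<le> la k" using Suc assms(1) by (auto simp: antimono_def)
      ultimately show ?thesis using i Suc by simp
    qed
    then have "(i, j) \<in> T" using i by (simp add: T_def)
    then show "j \<in> snd ` T" by force
  qed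
  moreover have "T \<subseteq> skew_cells la mu"
    by (auto simp: T_def skew_cells_def)
  ultimately have img: "snd ` skew_cells la mu = snd ` T" by blast
  have "inj_on snd T"
  proof -
    \<comment> \<open>A topmost cell lies left of the start \<open>mu l\<close> of the row above it,
      hence left of the start of every higher row.\<close>
    have lt: False if "(i, j) \<in> T" "(k, j) \<in> T" "i < k" for i k j
    proof -
      obtain l where l: "k = Suc l" using \<open>i < k\<close> by (cases k) auto
      have "mu l \<le> mu i" using l \<open>i < k\<close> by (intro mu) simp
      then show False using that l by (simp add: T_def)
    qed
    show ?thesis
    proof (rule inj_onI, clarify)
      fix i k j l assume "(i, j) \<in> T" "(k, l) \<in> T" "snd (i, j) = snd (k, l)"
      then show "i = k \<and> j = l" using lt[of i j k] lt[of k j i] by (cases i k rule: linorder_cases) auto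
    qed
  qed
  then show ?thesis
    by (simp add: num_cols_def img card_image T_def)
qed

text \<open>The top row of the component through row \<open>i\<close>: for partitions, consecutive
  rows share a column exactly when \<open>mu i < la (Suc i)\<close>.\<close>

fun component_top :: "(nat \<Rightarrow> nat) \<Rightarrow> (nat \<Rightarrow> nat) \<Rightarrow> nat \<Rightarrow> nat" where
  "component_top la mu 0 = 0"
| "component_top la mu (Suc i) = (if mu i < la (Suc i) then component_top la mu i else Suc i)"

text \<open>Each component is counted at its topmost row.\<close>

lemma num_components_skew:
  assumes "antimono la" "antimono mu"
  shows "num_components (skew_cells la mu) =
    card {i. mu i < la i \<and> la i \<le> row_bound la mu i}"
proof -
  define D where "D = skew_cells la mu"
  define E where "E = (edge_adjacent D)\<^sup>*"
  define K where "K = {i. mu i < la i \<and> la i \<le> row_bound la mu i}"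
  have memD: "(i, j) \<in> D \<longleftrightarrow> mu i \<le> j \<and> j < la i" for i j
    by (simp add: D_def skew_cells_def)
  have "sym (edge_adjacent D)"
    unfolding edge_adjacent_def sym_def by auto
  then have symE: "sym E" unfolding E_def by (rule sym_rtrancl)
  have equivE: "equiv UNIV E"
    unfolding equiv_def using symE by (simp add: E_def refl_rtrancl trans_rtrancl)
  \<comment> \<open>An invariant that separates components: the top row does not change along an
    edge.\<close>
  have adj_top: "component_top la mu (fst x) = component_top la mu (fst y)"
    if "(x, y) \<in> edge_adjacent D" for x y
  proof -
    have "component_top la mu (Suc i) = component_top la mu i"
      if "(i, j) \<in> D" "(Suc i, j) \<in> D" for i j
      using that by (simp add: memD)
    then show ?thesis
      using that by (auto simp: edge_adjacent_def simp del: component_top.simps(2))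
  qed
  have top_inv: "component_top la mu (fst x) = component_top la mu (fst y)" if "(x, y) \<in> E" for x y
    using that unfolding E_def by (induction rule: rtrancl_induct) (auto dest: adj_top)
  have top_K: "component_top la mu i = i" if "i \<in> K" for i
    using that by (cases i) (auto simp: K_def)
  have row: "((i, j), (i, mu i)) \<in> E" if "(i, j) \<in> D" for i j
    using that
  proof (induction j)
    case 0
    then show ?case by (simp add: memD E_def)
  next
    case (Suc j)
    show ?case
    proof (cases "mu i = Suc j")
      case True
      then show ?thesis by (simp add: E_def)
    next
      case False
      then have "(i, j) \<in> D" using Suc.prems by (simp add: memD)
      moreover have "((i, Suc j), (i, j)) \<in> edge_adjacent D"
        using Suc.prems \<open>(i, j) \<in> D\<close> by (simp add: edge_adjacent_def)
      ultimately show ?thesis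
        using Suc.IH unfolding E_def by (meson converse_rtrancl_into_rtrancl)
    qed
  qed
  \<comment> \<open>The climb from row \<open>Suc i\<close> to row \<open>i\<close> goes through
    column \<open>mu i\<close>, where row \<open>i\<close> starts and which both rows
    contain.\<close>
  have to_top: "component_top la mu i \<in> K \<and>
      ((i, mu i), (component_top la mu i, mu (component_top la mu i))) \<in> E" if "mu i < la i" for i
    using that
  proof (induction i)
    case 0
    then show ?case by (simp add: K_def E_def)
  next
    case (Suc i)
    show ?case
    proof (cases "mu i < la (Suc i)")
      case True
      have le: "la (Suc i) \<le> la i" "mu (Suc i) \<le> mu i"
        using assms by (auto simp: antimono_def)
      then have cells: "(i, mu i) \<in> D" "(Suc i, mu i) \<in> D"
        using True by (auto simp: memD)
      have "((Suc i, mu i), (i, mu i)) \<in> edge_adjacent D"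
        using cells by (simp add: edge_adjacent_def)
      then have "((Suc i, mu i), (i, mu i)) \<in> E" unfolding E_def by blast
      moreover have "((Suc i, mu (Suc i)), (Suc i, mu i)) \<in> E"
        using row[OF cells(2)] symE by (meson symD)
      moreover have "component_top la mu i \<in> K \<and>
          ((i, mu i), (component_top la mu i, mu (component_top la mu i))) \<in> E"
        using Suc.IH True le by simp
      ultimately show ?thesis
        using True unfolding E_def by (auto intro: rtrancl_trans)
    next
      case False
      then show ?thesis using Suc.prems by (simp add: K_def E_def)
    qed
  qed
  have "bij_betw (\<lambda>i. E `` {(i, mu i)}) K (D // E)"
  proof (rule bij_betw_imageI)
    show "inj_on (\<lambda>i. E `` {(i, mu i)}) K"
    proof (rule inj_onI)
      fix i k assume ik: "i \<in> K" "k \<in> K" "E `` {(i, mu i)} = E `` {(k, mu k)}"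
      then have "((i, mu i), (k, mu k)) \<in> E"
        using eq_equiv_class[OF _ equivE] by auto
      then show "i = k" using top_inv ik top_K by fastforce
    qed
    show "(\<lambda>i. E `` {(i, mu i)}) ` K = D // E"
    proof
      show "(\<lambda>i. E `` {(i, mu i)}) ` K \<subseteq> D // E"
        by (auto simp: K_def memD intro!: quotientI)
      show "D // E \<subseteq> (\<lambda>i. E `` {(i, mu i)}) ` K"
      proof
        fix X assume "X \<in> D // E"
        then obtain i j where ij: "(i, j) \<in> D" "X = E `` {(i, j)}"
          by (auto elim!: quotientE)
        let ?k = "component_top la mu i"
        have k: "?k \<in> K" "((i, mu i), (?k, mu ?k)) \<in> E"
          using to_top[of i] ij by (auto simp: memD)
        have "((i, j), (?k, mu ?k)) \<in> E"
          using row[OF ij(1)] k(2) unfolding E_def by (rule rtrancl_trans)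
        then have "X = E `` {(?k, mu ?k)}"
          using ij equiv_class_eq[OF equivE] by blast
        then show "X \<in> (\<lambda>i. E `` {(i, mu i)}) ` K" using k by blast
      qed
    qed
  qed
  then show ?thesis
    using bij_betw_same_card by (fastforce simp: num_components_def D_def E_def K_def)
qed

section \<open>Statistics of skew shapes as sums over rows\<close>

lemma psize_eq_sum:
  assumes "\<And>i. i \<ge> M \<Longrightarrow> la i = 0"
  shows "psize la = (\<Sum>i<M. la i)"
proof -
  have "{i. la i \<noteq> 0} \<subseteq> {..<M}"
  proof
    fix i assume "i \<in> {i. la i \<noteq> 0}"
    then show "i \<in> {..<M}" using assms[of i] by (cases "M \<le> i") auto
  qed
  then show ?thesis
    unfolding psize_def by (intro sum.mono_neutral_left) auto
qed

lemma psize_diff_eq_sum: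
  assumes "mu \<le> la" "\<And>i. i \<ge> M \<Longrightarrow> la i = 0"
  shows "psize la - psize mu = (\<Sum>i<M. la i - mu i)"
proof -
  have "mu i = 0" if "i \<ge> M" for i
    using assms(1) assms(2)[OF that] by (metis le_funD le_zero_eq)
  then show ?thesis
    using assms by (simp add: psize_eq_sum[of M] sum_subtractf_nat le_fun_def)
qed

lemma card_eq_sum_of_bool:
  fixes P :: "nat \<Rightarrow> bool"
  assumes "\<And>i. i \<ge> M \<Longrightarrow> \<not> P i"
  shows "card {i. P i} = (\<Sum>i<M. of_bool (P i))"
proof -
  have "i < M" if "P i" for i
    using assms[of i] that by (cases "M \<le> i") auto
  then have "{..<M} \<inter> {i. P i} = {i. P i}" by auto
  then show ?thesis by (simp add: sum_of_bool_eq)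
qed

text \<open>All exponents are built from row statistics: \<open>R\<close> marks a nonempty row,
  \<open>B\<close> the top row of a component, \<open>C\<close> counts the columns whose topmost
  cell lies in the row, and \<open>Z\<close> its cells.\<close>

lemma dual_weight_eq_prod:
  fixes y :: "('v, 'a::comm_ring_1) mfps"
  assumes "antimono la" "antimono mu" and le: "mu \<le> la" and zero: "\<And>i. i \<ge> M \<Longrightarrow> la i = 0"
  shows "dual_weight \<alpha> \<beta> y la mu =
    (\<Prod>i<M. dual_rows.lower_row (mfps_const \<alpha>) (mfps_const \<beta>) y (row_bound la mu i) (mu i) (la i))"
proof -
  interpret dual_rows "mfps_const \<alpha>" "mfps_const \<beta>" y .
  define R B C Z where "R i = (of_bool (mu i < la i) :: nat)"
    and "B i = (of_bool (mu i < la i \<and> la i \<le> row_bound la mu i) :: nat)"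
    and "C i = min (la i) (row_bound la mu i) - mu i"
    and "Z i = la i - mu i" for i
  note defs = R_def B_def C_def Z_def
  have bound: "mu i \<le> row_bound la mu i" "mu i \<le> la i" for i
    using row_bound_ge[OF assms(2) le] le by (auto simp: le_fun_def)
  have r: "num_rows (skew_cells la mu) = (\<Sum>i<M. R i)"
    unfolding num_rows_skew defs by (rule card_eq_sum_of_bool) (simp add: zero)
  have b: "num_components (skew_cells la mu) = (\<Sum>i<M. B i)"
    unfolding num_components_skew[OF assms(1,2)] defs by (rule card_eq_sum_of_bool) (simp add: zero)
  have "i < M" if "j < la i" for i j
    using zero[of i] that by (cases "M \<le> i") auto
  then have "Sigma UNIV (\<lambda>i. {mu i..<min (la i) (row_bound la mu i)}) =
      Sigma {..<M} (\<lambda>i. {mu i..<min (la i) (row_bound la mu i)})"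
    by auto
  then have c: "num_cols (skew_cells la mu) = (\<Sum>i<M. C i)"
    unfolding num_cols_skew[OF assms(1,2)] defs by simp
  have z: "psize la - psize mu = (\<Sum>i<M. Z i)"
    unfolding defs using le zero by (rule psize_diff_eq_sum)
  \<comment> \<open>As these inequalities hold in each row, the truncated differences of the totals
    are the sums of the differences in the rows.\<close>
  have "B i \<le> R i" "B i \<le> C i" "R i + C i \<le> Z i + B i" for i
    using bound[of i] by (auto simp: defs)
  then have exps: "(\<Sum>i<M. R i) - (\<Sum>i<M. B i) = (\<Sum>i<M. R i - B i)"
    "(\<Sum>i<M. C i) - (\<Sum>i<M. B i) = (\<Sum>i<M. C i - B i)"
    "(\<Sum>i<M. Z i) + (\<Sum>i<M. B i) - ((\<Sum>i<M. R i) + (\<Sum>i<M. C i)) = (\<Sum>i<M. Z i + B i - (R i + C i))"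
    by (simp_all add: sum_subtractf_nat flip: sum.distrib)
  have "dual_weight \<alpha> \<beta> y la mu = (\<Prod>i<M. mfps_const \<beta> ^ (R i - B i) *
      mfps_const (\<alpha> + \<beta>) ^ (Z i + B i - (R i + C i)) * y ^ B i * (mfps_const \<alpha> + y) ^ (C i - B i))"
    by (simp add: dual_weight_def Let_def r b c z exps power_sum prod.distrib)
  also have "\<dots> = (\<Prod>i<M. lower_row (row_bound la mu i) (mu i) (la i))"
  proof (rule prod.cong)
    fix i
    show "mfps_const \<beta> ^ (R i - B i) * mfps_const (\<alpha> + \<beta>) ^ (Z i + B i - (R i + C i)) *
        y ^ B i * (mfps_const \<alpha> + y) ^ (C i - B i) = lower_row (row_bound la mu i) (mu i) (la i)"
      using bound[of i]
      by (cases "mu i = la i"; cases "la i \<le> row_bound la mu i")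
        (auto simp: defs lower_row_def top_row_def min_def mfps_const_add)
  qed simp
  finally show ?thesis .
qed

section \<open>Partitions and branching weights\<close>

lemma partitions_bound:
  assumes "la \<in> partitions"
  obtains N where "\<And>i. i \<ge> N \<Longrightarrow> la i = 0"
proof -
  have "finite {i. la i \<noteq> 0}" using assms by (simp add: partitions_def)
  then obtain N where "\<forall>i\<in>{i. la i \<noteq> 0}. i < N"
    using finite_nat_set_iff_bounded by blast
  then show ?thesis by (intro that[of N]) force
qed

lemma partitionsI:
  assumes "\<And>i. la (Suc i) \<le> la i" "\<And>i. i \<ge> N \<Longrightarrow> la i = 0"
  shows "la \<in> partitions"
proof -
  have "i < N" if "la i \<noteq> 0" for i
    using assms(2)[of i] that by (cases "N \<le> i") auto
  then have "{i. la i \<noteq> 0} \<subseteq> {..<N}" by auto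
  then show ?thesis
    using assms(1) by (simp add: partitions_def finite_subset antimono_iff_le_Suc)
qed

lemma empty_partition_in_partitions: "empty_partition \<in> partitions"
  by (rule partitionsI[of _ 0]) (simp_all add: empty_partition_def)

lemma psize_mono:
  assumes "la \<in> partitions" "mu \<le> la"
  shows "psize mu \<le> psize la"
proof -
  obtain N where N: "\<And>i. i \<ge> N \<Longrightarrow> la i = 0" using partitions_bound[OF assms(1)] by blast
  have "mu i = 0" if "i \<ge> N" for i
    using assms(2) N[OF that] by (metis le_funD le_zero_eq)
  then show ?thesis
    using N assms(2) by (simp add: psize_eq_sum[of N] sum_mono le_fun_def)
qed

lemma finite_partitions_psize: "finite {la \<in> partitions. psize la \<le> K}"
proof (rule finite_subset)
  let ?B = "\<lambda>i. if i < K then K else 0"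
  show "{la \<in> partitions. psize la \<le> K} \<subseteq> {f. \<forall>i. f i \<le> ?B i}"
  proof (intro subsetI CollectI allI)
    fix la i assume la: "la \<in> {la \<in> partitions. psize la \<le> K}"
    then have anti: "antimono la" by (simp add: partitions_def)
    obtain N where N: "\<And>i. i \<ge> N \<Longrightarrow> la i = 0"
      using la partitions_bound by auto
    have K: "(\<Sum>i<N + Suc i. la i) \<le> K"
      using la psize_eq_sum[of "N + Suc i" la] N by simp
    \<comment> \<open>The first \<open>Suc i\<close> parts are all at least \<open>la i\<close>, so
      a nonzero part has both its index and its size bounded by \<open>K\<close>.\<close>
    have "(Suc i) * la i = (\<Sum>j<Suc i. la i)" by simp
    also have "\<dots> \<le> (\<Sum>j<Suc i. la j)"
      using anti by (intro sum_mono) (auto simp: antimono_def)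
    also have "\<dots> \<le> (\<Sum>j<N + Suc i. la j)"
      by (intro sum_mono2) auto
    finally have *: "Suc i * la i \<le> K" using K by simp
    show "la i \<le> ?B i"
    proof (cases "la i = 0")
      case False
      then have "Suc i * 1 \<le> Suc i * la i" "1 * la i \<le> Suc i * la i"
        by (intro mult_le_mono; simp)+
      then show ?thesis using * by auto
    qed simp
  qed
  have "{i. ?B i \<noteq> 0} \<subseteq> {..<K}" by auto
  then show "finite {f. \<forall>i. f i \<le> ?B i}"
    by (intro finite_le_fun) (rule finite_subset, auto)
qed

text \<open>The arguments \<open>u\<close> and \<open>v\<close> stand for the two quotients in the
  branching rule of \<open>canonical_G\<close>. The value 0 off horizontal strips lets sums range
  over all partitions.\<close>

definition strip_weight :: "'b::comm_ring_1 \<Rightarrow> 'b \<Rightarrow> (nat \<Rightarrow> nat) \<Rightarrow> (nat \<Rightarrow> nat) \<Rightarrow> 'b" where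
  "strip_weight u v la mu =
    (if horizontal_strip la mu then u ^ (psize la - psize mu) * v ^ row_excess mu (drop_first la) else 0)"

definition dual_branch ::
  "'a::comm_ring_1 \<Rightarrow> 'a \<Rightarrow> ('v, 'a) mfps \<Rightarrow> (nat \<Rightarrow> nat) \<Rightarrow> (nat \<Rightarrow> nat) \<Rightarrow> ('v, 'a) mfps" where
  "dual_branch \<alpha> \<beta> y la mu = (if mu \<le> la then dual_weight \<alpha> \<beta> y la mu else 0)"

lemma horizontal_strip_le: "horizontal_strip la mu \<Longrightarrow> mu \<le> la"
  by (simp add: horizontal_strip_def le_fun_def)

text \<open>Two bounds are kept because \<lambda> may have one part more than \<mu>, while the
  factors \<open>v\<close> are indexed by the rows of \<mu>.\<close>

lemma strip_weight_eq_prod: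
  assumes "horizontal_strip la mu" "\<And>i. i \<ge> M \<Longrightarrow> la i = 0" "\<And>i. i \<ge> N \<Longrightarrow> mu i = 0"
  shows "strip_weight u v la mu =
    (\<Prod>i<M. u ^ (la i - mu i)) * (\<Prod>i<N. if la (Suc i) < mu i then v else 1)"
proof -
  have "row_excess mu (drop_first la) = (\<Sum>i<N. of_bool (la (Suc i) < mu i))"
    unfolding row_excess_def drop_first_def
    by (rule card_eq_sum_of_bool) (simp add: assms(3))
  then have "v ^ row_excess mu (drop_first la) = (\<Prod>i<N. v ^ of_bool (la (Suc i) < mu i))"
    by (simp only: power_sum)
  also have "\<dots> = (\<Prod>i<N. if la (Suc i) < mu i then v else 1)"
    by (intro prod.cong) auto
  finally show ?thesis
    using assms psize_diff_eq_sum[OF horizontal_strip_le[OF assms(1)] assms(2)]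
    by (simp add: strip_weight_def power_sum)
qed

text \<open>Each part is confined to its own interval, and only the first one is unbounded.
  Monotonicity comes back from \<open>la (Suc i) \<le> mu i \<le> la i\<close>. A horizontal strip
  can add one row, hence \<open>Suc N\<close>.\<close>

lemma strip_partitions_iff:
  assumes "\<And>i. i \<ge> N \<Longrightarrow> mu i = 0" "\<And>i. i \<ge> N \<Longrightarrow> nu i = 0"
  shows "la \<in> partitions \<and> horizontal_strip la mu \<and> nu \<le> la \<longleftrightarrow>
    (\<forall>i<Suc N. la i \<in> (case i of 0 \<Rightarrow> {max (mu 0) (nu 0)..}
       | Suc k \<Rightarrow> {max (mu (Suc k)) (nu (Suc k))..mu k})) \<and> (\<forall>i\<ge>Suc N. la i = 0)"
  (is "?L \<longleftrightarrow> ?R")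
proof
  assume L: ?L
  have "la i = 0" if "i \<ge> Suc N" for i
  proof -
    obtain k where "i = Suc k" "k \<ge> N" using \<open>i \<ge> Suc N\<close> by (cases i) auto
    then show ?thesis
      using L assms(1)[of k] by (metis horizontal_strip_def le_zero_eq)
  qed
  then show ?R
    using L by (auto simp: horizontal_strip_def le_fun_def split: nat.split)
next
  assume R: ?R
  have ge: "mu i \<le> la i" "nu i \<le> la i" for i
  proof -
    have "mu i \<le> la i \<and> nu i \<le> la i"
    proof (cases "i < Suc N")
      case True
      then have "la i \<in> (case i of 0 \<Rightarrow> {max (mu 0) (nu 0)..}
       | Suc k \<Rightarrow> {max (mu (Suc k)) (nu (Suc k))..mu k})" using R by blast
      then show ?thesis by (cases i) auto
    next
      case False
      then show ?thesis using assms[of i] by simp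
    qed
    then show "mu i \<le> la i" "nu i \<le> la i" by auto
  qed
  have le: "la (Suc i) \<le> mu i" for i
  proof (cases "i < N")
    case True
    then have "la (Suc i) \<in> {max (mu (Suc i)) (nu (Suc i))..mu i}"
      using R[THEN conjunct1, rule_format, of "Suc i"] by simp
    then show ?thesis by simp
  next
    case False
    then show ?thesis using R by simp
  qed
  have "la \<in> partitions"
    using R le ge by (intro partitionsI[of _ "Suc N"]) (blast intro: order.trans)+
  then show ?L using ge le by (auto simp: horizontal_strip_def le_fun_def)
qed

text \<open>Interlacing with \<nu> again makes the parts independent, now in bounded intervals, and
  implies monotonicity.\<close>

lemma removed_partitions_iff:
  assumes "\<And>i. i \<ge> N \<Longrightarrow> nu i = 0"
  shows "ka \<in> partitions \<and> horizontal_strip nu ka \<and> ka \<le> mu \<longleftrightarrow>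
    (\<forall>i<N. ka i \<in> {nu (Suc i)..min (nu i) (mu i)}) \<and> (\<forall>i\<ge>N. ka i = 0)"
  (is "?L \<longleftrightarrow> ?R")
proof
  assume L: ?L
  have "ka i = 0" if "i \<ge> N" for i
    using L assms[OF that] by (metis horizontal_strip_def le_zero_eq)
  then show ?R
    using L by (auto simp: horizontal_strip_def le_fun_def)
next
  assume R: ?R
  have ka: "ka i \<le> nu i" "ka i \<le> mu i" "nu (Suc i) \<le> ka i" for i
    using R assms[of "Suc i"] by (cases "i < N"; simp)+
  then have "ka \<in> partitions"
    using R by (intro partitionsI[of _ N]) (blast intro: order.trans)+
  then show ?L using ka by (simp add: horizontal_strip_def le_fun_def)
qed

section \<open>The skew Cauchy identity in one variable\<close>

locale strip_series =
  fixes \<alpha> \<beta> :: "'a::comm_ring_1" and u e :: "('v, 'a) mfps"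
  assumes unit: "(1 - mfps_const \<alpha> * u) * e = 1" and order_u: "order_ge 1 u"
begin

abbreviation strip where
  "strip \<equiv> strip_weight u (1 - (mfps_const \<alpha> + mfps_const \<beta>) * u)"

text \<open>In the application \<open>e * u\<close> is the variable x, so that \<open>Q\<close> is 1
  / (1 - x y).\<close>

context
  fixes y Q :: "('v, 'a) mfps"
  assumes Q: "(1 - e * u * y) * Q = 1"
begin

interpretation cauchy_weights "mfps_const \<alpha>" "mfps_const \<beta>" y u e
  by unfold_locales (rule unit)

text \<open>Up to an initial term this is a geometric series with ratio \<open>t * u\<close>. The
  factorisation 1 - (\<alpha> + y) u = (1 - e u y) (1 - \<alpha> u) relates its sum \<open>g\<close>
  to \<open>Q\<close>: one has Q = (1 - \<alpha> u) g and Q e = g.\<close>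

lemma first_row_sum:
  "mfps_has_sum (\<lambda>l. u ^ (l - p) * top_row a l) {max p a..} (Q * cocycle a p * top_row a p)"
proof -
  have "order_ge (0 + 1) (t * u)" by (intro order_ge_mult order_u) simp
  then obtain g where g: "mfps_has_sum (\<lambda>k. (t * u) ^ k) UNIV g" and g1: "(1 - t * u) * g = 1"
    using geometric_series[of "t * u"] by auto
  let ?A = "mfps_const \<alpha>"
  have "(1 - e * u * y) * (1 - ?A * u) = (1 - ?A * u) - ((1 - ?A * u) * e) * (u * y)"
    by (simp add: algebra_simps)
  also have "\<dots> = 1 - t * u"
    by (simp only: unit) (simp add: algebra_simps)
  finally have tu: "(1 - e * u * y) * (1 - ?A * u) = 1 - t * u" .
  have "Q = Q * ((1 - t * u) * g)" using g1 by simp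
  also have "\<dots> = ((1 - e * u * y) * Q) * ((1 - ?A * u) * g)"
    unfolding tu[symmetric] by (simp only: mult_ac)
  finally have Qg: "Q = (1 - ?A * u) * g" using Q by simp
  show ?thesis
  proof (cases "p \<le> a")
    case True
    have "mfps_has_sum (\<lambda>k. (u ^ (a - p) * u * y) * (t * u) ^ k) UNIV (u ^ (a - p) * u * y * g)"
      by (rule mfps_has_sum_cmult[OF g])
    moreover have "(u ^ (a - p) * u * y) * (t * u) ^ k = u ^ (k + Suc a - p) * top_row a (k + Suc a)" for k
    proof -
      have "k + Suc a - p = (a - p) + 1 + k" using True by simp
      then have "u ^ (k + Suc a - p) = u ^ (a - p) * u * u ^ k" by (simp only: power_add power_one_right)
      then show ?thesis by (simp add: top_row_def power_mult_distrib mult_ac)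
    qed
    ultimately have "mfps_has_sum (\<lambda>k. u ^ (k + Suc a - p) * top_row a (k + Suc a)) UNIV
        (u ^ (a - p) * u * y * g)" by simp
    moreover have "inj (\<lambda>k. k + Suc a)" by (simp add: inj_on_def)
    ultimately have "mfps_has_sum (\<lambda>l. u ^ (l - p) * top_row a l) (range (\<lambda>k. k + Suc a))
        (u ^ (a - p) * u * y * g)" by (simp only: mfps_has_sum_reindex)
    \<comment> \<open>The term \<open>l = a\<close> is an empty row of weight 1, outside the
      geometric pattern.\<close>
    then have "mfps_has_sum (\<lambda>l. u ^ (l - p) * top_row a l) (insert a (range (\<lambda>k. k + Suc a)))
        (u ^ (a - p) * top_row a a + u ^ (a - p) * u * y * g)"
      by (rule mfps_has_sum_insert) auto
    moreover have "insert a (range (\<lambda>k. k + Suc a)) = {max p a..}"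
    proof -
      have "l = a \<or> (\<exists>k. l = k + Suc a)" if "a \<le> l" for l
        using that by (cases "l = a") (auto intro: exI[of _ "l - Suc a"])
      then show ?thesis using True by auto
    qed
    moreover have "u ^ (a - p) * top_row a a + u ^ (a - p) * u * y * g = Q * cocycle a p * top_row a p"
    proof -
      have "1 + u * y * g = (1 - t * u) * g + u * y * g" by (simp only: g1)
      also have "\<dots> = Q" unfolding Qg by (simp add: algebra_simps)
      finally have "u ^ (a - p) * (1 + u * y * g) = u ^ (a - p) * Q" by simp
      then show ?thesis
        using True by (simp add: top_row_def cocycle_def distrib_left mult_ac)
    qed
    ultimately show ?thesis by simp
  next
    case False
    have "mfps_has_sum (\<lambda>k. top_row a p * (t * u) ^ k) UNIV (top_row a p * g)"
      by (rule mfps_has_sum_cmult[OF g])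
    moreover have "top_row a p * (t * u) ^ k = u ^ (k + p - p) * top_row a (k + p)" for k
    proof -
      have "k + p - a - 1 = (p - a - 1) + k" using False by simp
      then have "t ^ (k + p - a - 1) = t ^ (p - a - 1) * t ^ k" by (simp only: power_add)
      then show ?thesis using False by (simp add: top_row_def power_mult_distrib mult_ac)
    qed
    ultimately have "mfps_has_sum (\<lambda>k. u ^ (k + p - p) * top_row a (k + p)) UNIV (top_row a p * g)"
      by simp
    moreover have "inj (\<lambda>k. k + p)" by (simp add: inj_on_def)
    ultimately have "mfps_has_sum (\<lambda>l. u ^ (l - p) * top_row a l) (range (\<lambda>k. k + p)) (top_row a p * g)"
      by (simp only: mfps_has_sum_reindex)
    moreover have "range (\<lambda>k. k + p) = {max p a..}"
    proof -
      have "\<exists>k. l = k + p" if "p \<le> l" for l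
        using that by (auto intro: exI[of _ "l - p"])
      then show ?thesis using False by auto
    qed
    moreover have "top_row a p * g = Q * cocycle a p * top_row a p"
    proof -
      have "Q * e = ((1 - ?A * u) * e) * g" unfolding Qg by (simp only: mult_ac)
      then have "Q * e = g" by (simp only: unit mult_1_left)
      then show ?thesis using False by (simp add: cocycle_def mult_ac)
    qed
    ultimately show ?thesis by simp
  qed
qed

lemma removed_rows_sum:
  assumes "mu \<in> partitions" "nu \<in> partitions"
    and zero: "\<And>i. i \<ge> N \<Longrightarrow> mu i = 0" "\<And>i. i \<ge> N \<Longrightarrow> nu i = 0"
  shows "(\<Sum>ka | ka \<in> partitions \<and> ka \<le> mu. strip nu ka * dual_branch \<alpha> \<beta> y mu ka) =
    top_row (nu 0) (mu 0) * (\<Prod>i<N. remove_row (mu (Suc i)) (mu i) (nu (Suc i)) (nu i))"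
proof -
  define T where "T = {ka. (\<forall>i<N. ka i \<in> {nu (Suc i)..min (nu i) (mu i)}) \<and> (\<forall>i\<ge>N. ka i = 0)}"
  have T: "ka \<in> T \<longleftrightarrow> ka \<in> partitions \<and> horizontal_strip nu ka \<and> ka \<le> mu" for ka
    unfolding T_def using removed_partitions_iff[OF zero(2)] by simp
  have fin: "finite {ka. ka \<in> partitions \<and> ka \<le> mu}"
    using finite_subpartitions[OF assms(1)] by simp
  then have finT: "finite T" by (rule rev_finite_subset) (auto simp: T)
  \<comment> \<open>Collects what depends on \<open>ka i\<close>: the strip weight, the end of row
    \<open>i\<close> of \<mu>/\<kappa> and the link to the row below.\<close>
  define \<rho> where "\<rho> i k = u ^ (nu i - k) * (if nu (Suc i) < k then v else 1) *
      (row_end (nu i) (mu i) k * row_link (nu (Suc i)) (mu (Suc i)) k)" for i k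
  have weight: "strip nu ka * dual_branch \<alpha> \<beta> y mu ka =
      top_row (nu 0) (mu 0) * (\<Prod>i<N. \<rho> i (ka i))" if "ka \<in> T" for ka
  proof -
    have ka: "ka \<in> partitions" "horizontal_strip nu ka" "ka \<le> mu" "\<And>i. i \<ge> N \<Longrightarrow> ka i = 0"
      using that T by (auto simp: T_def)
    have anti: "antimono mu" "antimono ka" using ka assms by (auto simp: partitions_def)
    have le: "ka i \<le> nu i" "nu (Suc i) \<le> ka i" "ka i \<le> mu i" for i
      using ka by (auto simp: horizontal_strip_def le_fun_def)
    have "dual_branch \<alpha> \<beta> y mu ka =
        (\<Prod>i<Suc N. lower_row (row_bound mu ka i) (ka i) (mu i))"
      using ka zero by (simp add: dual_branch_def dual_weight_eq_prod[OF anti ka(3), of "Suc N"])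
    also have "\<dots> = lower_row (mu 0) (ka 0) (mu 0) *
        (\<Prod>i<N. lower_row (ka i) (ka (Suc i)) (mu (Suc i)))"
      by (subst prod.lessThan_Suc_shift) simp
    also have "lower_row (mu 0) (ka 0) (mu 0) = top_row (nu 0) (mu 0) * row_end (nu 0) (mu 0) (ka 0)"
      using le(1)[of 0] by (simp add: lower_row_def top_row_split)
    also have "(\<Prod>i<N. lower_row (ka i) (ka (Suc i)) (mu (Suc i))) =
        (\<Prod>i<N. row_end (nu (Suc i)) (mu (Suc i)) (ka (Suc i))) *
        (\<Prod>i<N. row_link (nu (Suc i)) (mu (Suc i)) (ka i))"
      unfolding prod.distrib[symmetric] using le by (intro prod.cong lower_row_split) auto
    also have "top_row (nu 0) (mu 0) * row_end (nu 0) (mu 0) (ka 0) *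
        ((\<Prod>i<N. row_end (nu (Suc i)) (mu (Suc i)) (ka (Suc i))) *
        (\<Prod>i<N. row_link (nu (Suc i)) (mu (Suc i)) (ka i))) =
        top_row (nu 0) (mu 0) * (\<Prod>i<Suc N. row_end (nu i) (mu i) (ka i)) *
        (\<Prod>i<N. row_link (nu (Suc i)) (mu (Suc i)) (ka i))"
      by (subst prod.lessThan_Suc_shift) (simp add: mult_ac)
    \<comment> \<open>The factor for \<open>i = N\<close> is 1, since the parts of \<mu>, \<nu> and
      \<kappa> vanish there.\<close>
    also have "(\<Prod>i<Suc N. row_end (nu i) (mu i) (ka i)) = (\<Prod>i<N. row_end (nu i) (mu i) (ka i))"
      using zero[of N] ka(4)[of N] by (simp add: row_end_def top_row_def)
    finally have "dual_branch \<alpha> \<beta> y mu ka = top_row (nu 0) (mu 0) *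
        ((\<Prod>i<N. row_end (nu i) (mu i) (ka i)) * (\<Prod>i<N. row_link (nu (Suc i)) (mu (Suc i)) (ka i)))"
      by (simp add: mult_ac)
    then show ?thesis
      using strip_weight_eq_prod[OF ka(2), of N N u v] zero ka(4)
      by (simp add: \<rho>_def prod.distrib mult_ac)
  qed
  have "(\<Sum>ka | ka \<in> partitions \<and> ka \<le> mu. strip nu ka * dual_branch \<alpha> \<beta> y mu ka) =
      (\<Sum>ka\<in>T. strip nu ka * dual_branch \<alpha> \<beta> y mu ka)"
    using fin by (intro sum.mono_neutral_right) (auto simp: T strip_weight_def)
  also have "\<dots> = top_row (nu 0) (mu 0) * (\<Sum>ka\<in>T. \<Prod>i<N. \<rho> i (ka i))"
    by (simp add: weight sum_distrib_left)
  also have "(\<Sum>ka\<in>T. \<Prod>i<N. \<rho> i (ka i)) = (\<Prod>i<N. \<Sum>k = nu (Suc i)..min (nu i) (mu i). \<rho> i k)"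
  \<comment> \<open>The finite distributive law, obtained from uniqueness of sums.\<close>
  proof (rule mfps_has_sum_unique)
    show "mfps_has_sum (\<lambda>ka. \<Prod>i<N. \<rho> i (ka i)) T (\<Sum>ka\<in>T. \<Prod>i<N. \<rho> i (ka i))"
      using finT by (rule mfps_has_sum_finite)
    show "mfps_has_sum (\<lambda>ka. \<Prod>i<N. \<rho> i (ka i)) T
        (\<Prod>i<N. \<Sum>k = nu (Suc i)..min (nu i) (mu i). \<rho> i k)"
      unfolding T_def by (rule mfps_has_sum_prod) (rule mfps_has_sum_finite, simp)
  qed
  finally show ?thesis by (simp add: \<rho>_def remove_row_def)
qed

lemma skew_cauchy:
  assumes mu: "mu \<in> partitions" and nu: "nu \<in> partitions"
  shows "mfps_has_sum (\<lambda>la. strip la mu * dual_branch \<alpha> \<beta> y la nu) partitions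
    (Q * (\<Sum>ka | ka \<in> partitions \<and> ka \<le> mu. strip nu ka * dual_branch \<alpha> \<beta> y mu ka))"
proof -
  obtain N1 where N1: "\<And>i. i \<ge> N1 \<Longrightarrow> mu i = 0" using partitions_bound[OF mu] by blast
  obtain N2 where N2: "\<And>i. i \<ge> N2 \<Longrightarrow> nu i = 0" using partitions_bound[OF nu] by blast
  define N where "N = max N1 N2"
  have zero: "mu i = 0" "nu i = 0" if "i \<ge> N" for i
    using that N1 N2 by (auto simp: N_def)
  define B where "B i = (case i of 0 \<Rightarrow> {max (mu 0) (nu 0)..}
       | Suc k \<Rightarrow> {max (mu (Suc k)) (nu (Suc k))..mu k})" for i
  define S where "S = {la. (\<forall>i<Suc N. la i \<in> B i) \<and> (\<forall>i\<ge>Suc N. la i = 0)}"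
  have S: "la \<in> S \<longleftrightarrow> la \<in> partitions \<and> horizontal_strip la mu \<and> nu \<le> la" for la
    unfolding S_def B_def using strip_partitions_iff[of N mu nu la] zero by simp
  \<comment> \<open>No part of \<mu> bounds row 0 and no row lies above it, so it carries neither a
    factor \<open>v\<close> nor an overlap.\<close>
  define \<phi> where "\<phi> i l = (case i of 0 \<Rightarrow> u ^ (l - mu 0) * top_row (nu 0) l
      | Suc k \<Rightarrow> u ^ (l - mu (Suc k)) * (if l < mu k then v else 1) *
          lower_row (nu k) (nu (Suc k)) l)" for i l
  define L where "L i = (case i of 0 \<Rightarrow> Q * cocycle (nu 0) (mu 0) * top_row (nu 0) (mu 0)
      | Suc k \<Rightarrow> add_row (mu (Suc k)) (mu k) (nu (Suc k)) (nu k))" for i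
  have "mfps_has_sum (\<phi> i) (B i) (L i)" for i
  proof (cases i)
    case 0
    then show ?thesis using first_row_sum by (simp add: \<phi>_def[abs_def] B_def L_def)
  next
    case (Suc k)
    then show ?thesis
      by (simp add: \<phi>_def[abs_def] B_def L_def add_row_def mfps_has_sum_finite)
  qed
  then have "mfps_has_sum (\<lambda>la. \<Prod>i<Suc N. \<phi> i (la i)) S (\<Prod>i<Suc N. L i)"
    unfolding S_def by (rule mfps_has_sum_prod)
  moreover have "strip la mu * dual_branch \<alpha> \<beta> y la nu = (\<Prod>i<Suc N. \<phi> i (la i))" if "la \<in> S" for la
  proof -
    have la: "la \<in> partitions" "horizontal_strip la mu" "nu \<le> la" "\<And>i. i \<ge> Suc N \<Longrightarrow> la i = 0"
      using that S by (auto simp: S_def)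
    have anti: "antimono la" "antimono nu" using la nu by (auto simp: partitions_def)
    have "dual_branch \<alpha> \<beta> y la nu = (\<Prod>i<Suc N. lower_row (row_bound la nu i) (nu i) (la i))"
      using la zero by (simp add: dual_branch_def dual_weight_eq_prod[OF anti la(3), of "Suc N"])
    also have "\<dots> = top_row (nu 0) (la 0) * (\<Prod>i<N. lower_row (nu i) (nu (Suc i)) (la (Suc i)))"
      by (subst prod.lessThan_Suc_shift) (simp add: lower_row_def)
    finally have 1: "dual_branch \<alpha> \<beta> y la nu =
        top_row (nu 0) (la 0) * (\<Prod>i<N. lower_row (nu i) (nu (Suc i)) (la (Suc i)))" .
    have "strip la mu = (\<Prod>i<Suc N. u ^ (la i - mu i)) * (\<Prod>i<N. if la (Suc i) < mu i then v else 1)"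
      using la zero by (intro strip_weight_eq_prod) auto
    also have "\<dots> = u ^ (la 0 - mu 0) * (\<Prod>i<N. u ^ (la (Suc i) - mu (Suc i))) *
        (\<Prod>i<N. if la (Suc i) < mu i then v else 1)"
      by (subst prod.lessThan_Suc_shift) simp
    finally have 2: "strip la mu = u ^ (la 0 - mu 0) * (\<Prod>i<N. u ^ (la (Suc i) - mu (Suc i))) *
        (\<Prod>i<N. if la (Suc i) < mu i then v else 1)" .
    show ?thesis
      unfolding 1 2 by (subst prod.lessThan_Suc_shift) (simp add: \<phi>_def prod.distrib mult_ac)
  qed
  ultimately have "mfps_has_sum (\<lambda>la. strip la mu * dual_branch \<alpha> \<beta> y la nu) S (\<Prod>i<Suc N. L i)"
    by (subst mfps_has_sum_cong) auto
  then have main: "mfps_has_sum (\<lambda>la. strip la mu * dual_branch \<alpha> \<beta> y la nu) partitions (\<Prod>i<Suc N. L i)"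
    by (rule mfps_has_sum_neutral) (auto simp: S strip_weight_def dual_branch_def)
  have "(\<Prod>i<Suc N. L i) = Q * top_row (nu 0) (mu 0) * (cocycle (nu 0) (mu 0) *
      (\<Prod>i<N. add_row (mu (Suc i)) (mu i) (nu (Suc i)) (nu i)))"
    by (subst prod.lessThan_Suc_shift) (simp add: L_def mult_ac)
  also have "cocycle (nu 0) (mu 0) * (\<Prod>i<N. add_row (mu (Suc i)) (mu i) (nu (Suc i)) (nu i)) =
      (\<Prod>i<N. remove_row (mu (Suc i)) (mu i) (nu (Suc i)) (nu i)) * cocycle (nu N) (mu N)"
    using mu nu by (intro prod_add_row) (auto simp: partitions_def)
  also have "cocycle (nu N) (mu N) = 1"
    using zero[of N] by (simp add: cocycle_def)
  also have "Q * top_row (nu 0) (mu 0) * ((\<Prod>i<N. remove_row (mu (Suc i)) (mu i) (nu (Suc i)) (nu i)) * 1) =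
      Q * (\<Sum>ka | ka \<in> partitions \<and> ka \<le> mu. strip nu ka * dual_branch \<alpha> \<beta> y mu ka)"
    using removed_rows_sum[OF mu nu zero] by (simp add: mult.assoc)
  finally show ?thesis using main by simp
qed

end

section \<open>Passing one variable x through all variables y\<close>

lemma order_strip: "order_ge (psize la - psize mu) (strip la mu)"
proof (cases "horizontal_strip la mu")
  case True
  have "order_ge (psize la - psize mu + 0) (u ^ (psize la - psize mu) * w)" for w :: "('v, 'a) mfps"
    by (intro order_ge_mult order_ge_power order_u) simp
  then show ?thesis using True by (simp add: strip_weight_def)
qed (simp add: strip_weight_def order_ge_def)

text \<open>Induction on the number of y: the branching rule of \<open>dual_g\<close> introduces
  \<nu>, \<open>skew_cauchy\<close> exchanges the sum over \<lambda> for a finite sum over \<kappa>,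
  and the induction hypothesis at each \<kappa> evaluates the sum over \<nu>.\<close>

lemma strip_sum_dual_g:
  assumes Q: "\<And>j. (1 - e * u * y j) * Q j = 1" and mu: "mu \<in> partitions"
  shows "mfps_has_sum (\<lambda>la. strip la mu * dual_g \<alpha> \<beta> y n la) partitions
    ((\<Prod>j\<in>{1..n}. Q j) * dual_g \<alpha> \<beta> y n mu)"
  using mu
proof (induction n arbitrary: mu)
  case 0
  have "strip empty_partition mu = (if mu = empty_partition then 1 else 0)"
  proof -
    have "horizontal_strip empty_partition mu \<longleftrightarrow> mu = empty_partition"
      by (auto simp: horizontal_strip_def empty_partition_def)
    then show ?thesis
      by (auto simp: strip_weight_def row_excess_def empty_partition_def)
  qed
  moreover have "mfps_has_sum (\<lambda>la. strip la mu * dual_g \<alpha> \<beta> y 0 la) {empty_partition}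
      (\<Sum>la\<in>{empty_partition}. strip la mu * dual_g \<alpha> \<beta> y 0 la)"
    by (rule mfps_has_sum_finite) simp
  ultimately have "mfps_has_sum (\<lambda>la. strip la mu * dual_g \<alpha> \<beta> y 0 la) {empty_partition}
      ((\<Prod>j\<in>{1..0}. Q j) * dual_g \<alpha> \<beta> y 0 mu)"
    by simp
  then show ?case
    by (rule mfps_has_sum_neutral) (simp_all add: empty_partition_in_partitions)
next
  case (Suc n)
  let ?g = "dual_g \<alpha> \<beta> y n" and ?y = "y (Suc n)" and ?Q = "Q (Suc n)"
  let ?K = "{ka. ka \<in> partitions \<and> ka \<le> mu}"
  have finK: "finite {ka. ka \<in> partitions \<and> ka \<le> la}" if "la \<in> partitions" for la
    using finite_subpartitions[OF that] by simp
  show ?case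
  \<comment> \<open>The order of \<open>strip la mu\<close> bounds the size of \<lambda>, and \<nu>
    is contained in \<lambda>; this gives the joint finiteness.\<close>
  proof (rule mfps_has_sum_swap[where B = partitions
        and h = "\<lambda>la nu. strip la mu * (?g nu * dual_branch \<alpha> \<beta> ?y la nu)"
        and g = "\<lambda>nu. ?g nu * (?Q * (\<Sum>ka\<in>?K. strip nu ka * dual_branch \<alpha> \<beta> ?y mu ka))"])
    fix m :: "'v \<Rightarrow>\<^sub>0 nat"
    let ?P = "{la \<in> partitions. psize la \<le> monomial_degree m + psize mu}"
    show "finite {(la, nu) \<in> partitions \<times> partitions.
        mfps_coeff (strip la mu * (?g nu * dual_branch \<alpha> \<beta> ?y la nu)) m \<noteq> 0}"
    proof (rule finite_subset)
      show "finite (?P \<times> ?P)" by (intro finite_cartesian_product finite_partitions_psize)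
      show "{(la, nu) \<in> partitions \<times> partitions.
        mfps_coeff (strip la mu * (?g nu * dual_branch \<alpha> \<beta> ?y la nu)) m \<noteq> 0} \<subseteq> ?P \<times> ?P"
      proof clarify
        fix la nu assume *: "la \<in> partitions" "nu \<in> partitions"
          "mfps_coeff (strip la mu * (?g nu * dual_branch \<alpha> \<beta> ?y la nu)) m \<noteq> 0"
        have "order_ge (psize la - psize mu + 0) (strip la mu * (?g nu * dual_branch \<alpha> \<beta> ?y la nu))"
          by (intro order_ge_mult order_strip) simp
        then have "psize la \<le> monomial_degree m + psize mu"
          using *(3) by (force simp: order_ge_def)
        moreover have "nu \<le> la" using *(3) by (cases "nu \<le> la") (auto simp: dual_branch_def)
        ultimately show "la \<in> ?P \<and> nu \<in> ?P"
          using psize_mono[OF *(1)] * by force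
      qed
    qed
  next
    fix la assume la: "la \<in> partitions"
    have "mfps_has_sum (\<lambda>nu. ?g nu * dual_branch \<alpha> \<beta> ?y la nu) {nu. nu \<in> partitions \<and> nu \<le> la}
        (\<Sum>nu\<in>{nu. nu \<in> partitions \<and> nu \<le> la}. ?g nu * dual_branch \<alpha> \<beta> ?y la nu)"
      by (rule mfps_has_sum_finite[OF finK[OF la]])
    moreover have "(\<Sum>nu\<in>{nu. nu \<in> partitions \<and> nu \<le> la}. ?g nu * dual_branch \<alpha> \<beta> ?y la nu) =
        dual_g \<alpha> \<beta> y (Suc n) la"
      by (simp add: dual_branch_def)
    ultimately have "mfps_has_sum (\<lambda>nu. ?g nu * dual_branch \<alpha> \<beta> ?y la nu) {nu. nu \<in> partitions \<and> nu \<le> la}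
        (dual_g \<alpha> \<beta> y (Suc n) la)" by simp
    then have "mfps_has_sum (\<lambda>nu. ?g nu * dual_branch \<alpha> \<beta> ?y la nu) partitions (dual_g \<alpha> \<beta> y (Suc n) la)"
      by (rule mfps_has_sum_neutral) (auto simp: dual_branch_def)
    then show "mfps_has_sum (\<lambda>nu. strip la mu * (?g nu * dual_branch \<alpha> \<beta> ?y la nu)) partitions
        (strip la mu * dual_g \<alpha> \<beta> y (Suc n) la)"
      by (rule mfps_has_sum_cmult)
  next
    fix nu assume "nu \<in> partitions"
    then show "mfps_has_sum (\<lambda>la. strip la mu * (?g nu * dual_branch \<alpha> \<beta> ?y la nu)) partitions
        (?g nu * (?Q * (\<Sum>ka\<in>?K. strip nu ka * dual_branch \<alpha> \<beta> ?y mu ka)))"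
      using mfps_has_sum_cmult[OF skew_cauchy[OF Q Suc.prems], of nu "?g nu" "Suc n"]
      by (simp add: mult.left_commute)
  next
    have "mfps_has_sum (\<lambda>nu. \<Sum>ka\<in>?K. (?Q * dual_branch \<alpha> \<beta> ?y mu ka) * (strip nu ka * ?g nu)) partitions
        (\<Sum>ka\<in>?K. (?Q * dual_branch \<alpha> \<beta> ?y mu ka) * ((\<Prod>j\<in>{1..n}. Q j) * ?g ka))"
      by (intro mfps_has_sum_sum finK Suc.prems mfps_has_sum_cmult Suc.IH) auto
    moreover have "(\<Sum>ka\<in>?K. (?Q * dual_branch \<alpha> \<beta> ?y mu ka) * ((\<Prod>j\<in>{1..n}. Q j) * ?g ka)) =
        (\<Prod>j\<in>{1..Suc n}. Q j) * dual_g \<alpha> \<beta> y (Suc n) mu"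
      by (simp add: sum_distrib_left dual_branch_def mult_ac)
    moreover have "(\<Sum>ka\<in>?K. (?Q * dual_branch \<alpha> \<beta> ?y mu ka) * (strip nu ka * ?g nu)) =
        ?g nu * (?Q * (\<Sum>ka\<in>?K. strip nu ka * dual_branch \<alpha> \<beta> ?y mu ka))" for nu
      by (simp add: sum_distrib_left mult_ac)
    ultimately show "mfps_has_sum
        (\<lambda>nu. ?g nu * (?Q * (\<Sum>ka\<in>?K. strip nu ka * dual_branch \<alpha> \<beta> ?y mu ka))) partitions
        ((\<Prod>j\<in>{1..Suc n}. Q j) * dual_g \<alpha> \<beta> y (Suc n) mu)"
      by simp
  qed
qed

end

section \<open>The Cauchy identity\<close>

text \<open>The bridge from x to \<open>u\<close> and \<open>e\<close>: reversing the signs of the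
  parameters makes \<open>e\<close> the denominator, and it is a unit because x has no constant
  term.\<close>

lemma strip_series_var:
  fixes \<alpha> \<beta> :: "'a::comm_ring_1" and x :: "('v, 'a) mfps"
  assumes "order_ge 1 x"
  defines "e \<equiv> 1 - mfps_const (- \<alpha>) * x"
  shows "strip_series \<alpha> (x / e) e" "e * (x / e) = x"
    "(1 + mfps_const (- \<beta>) * x) / e = 1 - (mfps_const \<alpha> + mfps_const \<beta>) * (x / e)"
proof -
  have "order_ge (0 + 1) (mfps_const (- \<alpha>) * x)" by (intro order_ge_mult assms) simp
  then have inv: "e * inverse e = 1" unfolding e_def by (intro mult_inverse_one_minus) simp
  have "order_ge (1 + 0) (x / e)"
    unfolding mfps_divide_def by (intro order_ge_mult assms) simp
  moreover have "(1 - mfps_const \<alpha> * (x / e)) * e = e - mfps_const \<alpha> * x * (e * inverse e)"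
    by (simp add: mfps_divide_def algebra_simps)
  ultimately show "strip_series \<alpha> (x / e) e"
    by unfold_locales (simp_all add: inv, simp add: e_def mfps_const_uminus)
  show "e * (x / e) = x"
    using inv by (metis mfps_divide_def mult.left_commute mult_1_right)
  have "(1 + mfps_const (- \<beta>) * x) / e = (e - (mfps_const \<alpha> + mfps_const \<beta>) * x) * inverse e"
    by (simp add: mfps_divide_def e_def mfps_const_uminus algebra_simps)
  also have "\<dots> = e * inverse e - (mfps_const \<alpha> + mfps_const \<beta>) * (x * inverse e)"
    by (simp only: left_diff_distrib mult.assoc)
  finally show "(1 + mfps_const (- \<beta>) * x) / e = 1 - (mfps_const \<alpha> + mfps_const \<beta>) * (x / e)"
    by (simp add: inv mfps_divide_def)
qed

lemma dual_g_empty: "dual_g \<alpha> \<beta> y n empty_partition = 1"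
proof (induction n)
  case (Suc n)
  have "{mu. mu \<in> partitions \<and> mu \<le> empty_partition} = {empty_partition}"
    using empty_partition_in_partitions by (auto simp: empty_partition_def le_fun_def)
  moreover have "dual_weight \<alpha> \<beta> (y (Suc n)) empty_partition empty_partition = 1"
    by (subst dual_weight_eq_prod[where M = 0]) (auto simp: empty_partition_def antimono_def)
  ultimately show ?case using Suc by simp
qed simp

text \<open>Every cell of \<lambda> contributes a factor without constant term. This is what makes
  supports finite in the sum over \<lambda>.\<close>

lemma order_canonical_G:
  assumes "\<And>i. order_ge 1 (x i)" "la \<in> partitions"
  shows "order_ge (psize la) (canonical_G \<alpha> \<beta> x m la)"
  using assms(2)
proof (induction m arbitrary: la)
  case 0
  then show ?case by (auto simp: order_ge_def psize_def empty_partition_def)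
next
  case (Suc m)
  show ?case
    unfolding canonical_G.simps
  proof (rule order_ge_sum, clarify)
    fix mu assume mu: "mu \<in> partitions" "horizontal_strip la mu"
    have "order_ge (1 + 0) (x (Suc m) / (1 - mfps_const \<alpha> * x (Suc m)))"
      unfolding mfps_divide_def by (intro order_ge_mult assms) simp
    then have "order_ge (psize mu + (psize la - psize mu) + 0) (canonical_G \<alpha> \<beta> x m mu *
       (x (Suc m) / (1 - mfps_const \<alpha> * x (Suc m))) ^ (psize la - psize mu) *
       ((1 + mfps_const \<beta> * x (Suc m)) / (1 - mfps_const \<alpha> * x (Suc m))) ^ row_excess mu (drop_first la))"
      using mu by (intro order_ge_mult order_ge_power Suc.IH) auto
    then show "order_ge (psize la) (canonical_G \<alpha> \<beta> x m mu *
       (x (Suc m) / (1 - mfps_const \<alpha> * x (Suc m))) ^ (psize la - psize mu) *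
       ((1 + mfps_const \<beta> * x (Suc m)) / (1 - mfps_const \<alpha> * x (Suc m))) ^ row_excess mu (drop_first la))"
      using psize_mono[OF Suc.prems horizontal_strip_le[OF mu(2)]] by simp
  qed
qed

text \<open>Induction on the number of x. Branching at the last x introduces \<mu>; after the sums
  are exchanged, \<open>strip_sum_dual_g\<close> evaluates the sum over \<lambda> and leaves the
  factors of that x times the identity for the remaining ones.\<close>

lemma cauchy_identity:
  fixes x y :: "nat \<Rightarrow> ('v, 'a::comm_ring_1) mfps"
  assumes x: "\<And>i. order_ge 1 (x i)"
  shows "mfps_has_sum (\<lambda>la. canonical_G (- \<alpha>) (- \<beta>) x m la * dual_g \<alpha> \<beta> y n la) partitions
    (\<Prod>i\<in>{1..m}. \<Prod>j\<in>{1..n}. 1 / (1 - x i * y j))"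
proof (induction m)
  case 0
  have "mfps_has_sum (\<lambda>la. canonical_G (- \<alpha>) (- \<beta>) x 0 la * dual_g \<alpha> \<beta> y n la) {empty_partition}
      (\<Sum>la\<in>{empty_partition}. canonical_G (- \<alpha>) (- \<beta>) x 0 la * dual_g \<alpha> \<beta> y n la)"
    by (rule mfps_has_sum_finite) simp
  then have "mfps_has_sum (\<lambda>la. canonical_G (- \<alpha>) (- \<beta>) x 0 la * dual_g \<alpha> \<beta> y n la) {empty_partition}
      (\<Prod>i\<in>{1..0}. \<Prod>j\<in>{1..n}. 1 / (1 - x i * y j))"
    by (simp add: dual_g_empty)
  then show ?case
    by (rule mfps_has_sum_neutral) (simp_all add: empty_partition_in_partitions)
next
  case (Suc m)
  let ?x = "x (Suc m)" and ?G = "canonical_G (- \<alpha>) (- \<beta>) x" and ?g = "dual_g \<alpha> \<beta> y n"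
  define e where "e = 1 - mfps_const (- \<alpha>) * ?x"
  define u where "u = ?x / e"
  define Q where "Q j = 1 / (1 - ?x * y j)" for j
  note var = strip_series_var[where \<alpha> = \<alpha>, OF x[of "Suc m"], folded e_def, folded u_def]
  interpret strip_series \<alpha> \<beta> u e by (rule var(1))
  have Q: "(1 - e * u * y j) * Q j = 1" for j
  proof -
    have "order_ge (1 + 0) (?x * y j)" by (intro order_ge_mult x) simp
    then show ?thesis
      unfolding var(2) Q_def mfps_divide_def by (simp add: mult_inverse_one_minus)
  qed
  have G_Suc: "?G (Suc m) la = (\<Sum>mu | mu \<in> partitions \<and> horizontal_strip la mu. ?G m mu * strip la mu)" for la
    unfolding canonical_G.simps e_def[symmetric] u_def[symmetric] var(3)
    by (intro sum.cong) (auto simp: strip_weight_def mult.assoc)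
  show ?case
  proof (rule mfps_has_sum_swap[where B = partitions
        and h = "\<lambda>la mu. ?G m mu * strip la mu * ?g la"
        and g = "\<lambda>mu. ?G m mu * ((\<Prod>j\<in>{1..n}. Q j) * ?g mu)"])
    fix k :: "'v \<Rightarrow>\<^sub>0 nat"
    let ?P = "{la \<in> partitions. psize la \<le> monomial_degree k}"
    show "finite {(la, mu) \<in> partitions \<times> partitions.
        mfps_coeff (?G m mu * strip la mu * ?g la) k \<noteq> 0}"
    proof (rule finite_subset)
      show "finite (?P \<times> ?P)" by (intro finite_cartesian_product finite_partitions_psize)
      show "{(la, mu) \<in> partitions \<times> partitions.
        mfps_coeff (?G m mu * strip la mu * ?g la) k \<noteq> 0} \<subseteq> ?P \<times> ?P"
      proof clarify
        fix la mu assume *: "la \<in> partitions" "mu \<in> partitions"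
          "mfps_coeff (?G m mu * strip la mu * ?g la) k \<noteq> 0"
        \<comment> \<open>With truncated subtraction this order is still at least both sizes, so it
          bounds \<lambda> and \<mu> at once.\<close>
        have "order_ge (psize mu + (psize la - psize mu) + 0) (?G m mu * strip la mu * ?g la)"
          using * by (intro order_ge_mult order_strip order_canonical_G x) auto
        then have "psize mu + (psize la - psize mu) \<le> monomial_degree k"
          using *(3) by (force simp: order_ge_def)
        then show "la \<in> ?P \<and> mu \<in> ?P" using * by simp
      qed
    qed
  next
    fix la assume la: "la \<in> partitions"
    let ?K = "{mu. mu \<in> partitions \<and> horizontal_strip la mu}"
    have "finite ?K"
      by (rule finite_subset[OF _ finite_subpartitions[OF la]]) (auto dest: horizontal_strip_le)
    then have "mfps_has_sum (\<lambda>mu. ?G m mu * strip la mu) ?K (?G (Suc m) la)"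
      unfolding G_Suc by (rule mfps_has_sum_finite)
    then have "mfps_has_sum (\<lambda>mu. ?G m mu * strip la mu) partitions (?G (Suc m) la)"
      by (rule mfps_has_sum_neutral) (auto simp: strip_weight_def)
    from mfps_has_sum_cmult[OF this, of "?g la"]
    show "mfps_has_sum (\<lambda>mu. ?G m mu * strip la mu * ?g la) partitions (?G (Suc m) la * ?g la)"
      by (simp add: mult_ac)
  next
    fix mu assume "mu \<in> partitions"
    from mfps_has_sum_cmult[OF strip_sum_dual_g[OF Q this], of "?G m mu"]
    show "mfps_has_sum (\<lambda>la. ?G m mu * strip la mu * ?g la) partitions
        (?G m mu * ((\<Prod>j\<in>{1..n}. Q j) * ?g mu))"
      by (simp only: mult.assoc)
  next
    have "mfps_has_sum (\<lambda>mu. (\<Prod>j\<in>{1..n}. Q j) * (?G m mu * ?g mu)) partitions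
        ((\<Prod>j\<in>{1..n}. Q j) * (\<Prod>i\<in>{1..m}. \<Prod>j\<in>{1..n}. 1 / (1 - x i * y j)))"
      by (rule mfps_has_sum_cmult[OF Suc.IH])
    then show "mfps_has_sum (\<lambda>mu. ?G m mu * ((\<Prod>j\<in>{1..n}. Q j) * ?g mu)) partitions
        (\<Prod>i\<in>{1..Suc m}. \<Prod>j\<in>{1..n}. 1 / (1 - x i * y j))"
      by (simp add: Q_def mult_ac)
  qed
qed

theorem theorem6p2:
  fixes \<alpha> \<beta> :: "'a::comm_ring_1" and m n :: nat
  shows "mfps_has_sum
           (\<lambda>la. canonical_G (- \<alpha>) (- \<beta>) (\<lambda>i. mfps_var (Inl i)) m la *
                 dual_g \<alpha> \<beta> (\<lambda>j. mfps_var (Inr j)) n la)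
           partitions
           (\<Prod>i\<in>{1..m}. \<Prod>j\<in>{1..n}. 1 / (1 - mfps_var (Inl i) * mfps_var (Inr j))
              :: (nat + nat, 'a) mfps)"
  by (rule cauchy_identity) (rule order_ge_var)

end
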